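(* Let $p$ be an odd prime, let $k\in\mathbb{Z}_{\geq2}$ and let $z\in\mathbb{C}$ be a primitive $p^k$-th root of unity. Further, let $s:=(z^{a_1},\dots,z^{a_l})$ be a sum of $p^k$-th roots of unity of length $l$ with $a_1,\dots,a_l\in\mathbb{Z}$. (a) The relation $s_1\sim s_2:\Leftrightarrow |s_1|=|s_2|$ on the set of sums of $p^k$-th roots of unity is an equivalence relation. Further, each equivalence class has a unique minimal representative, and if $|s_1|=|s_2|$, then also $|s_1^{(p^k)}|=|s_2^{(p^k)}|$. (b) We have $$f_s=p^k\iff |s^{(p^k)}|\neq0.$$ In particular, if $p\nmid\lambda(s,p^k)$ or $p\nmid\tilde{\lambda}(s,p^k)$, then $f_s=p^k$. (c) We have $$p\mid[\mathbb{Q}_{p^k}:\mathbb{Q}(s)]\iff|s^{(p^k)}|=0.$$ In particular, if $p\nmid\lambda(s,p^k)$ or $p\nmid\tilde{\lambda}(s,p^k)$, then $p\nmid[\mathbb{Q}_{p^k}:\mathbb{Q}(s)]$.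
   Context: Let $n\in\mathbb{Z}_{\geq1}$ and let $z\in\mathbb{C}$ be a primitive $n$-th root of unity. A sum of $n$-th roots of unity of length $l$ is an $l$-tuple $s=(z^{a_1},\dots,z^{a_l})$ for some $a_1,\dots,a_l\in\mathbb{Z}$, where two such tuples are identified as the same if their entries coincide up to permutation. Its value is $|s|:=z^{a_1}+\dots+z^{a_l}$, and $s$ is called a vanishing sum if $|s|=0$. The subsequences of $s$ are called subsums of $s$. The sum $s$ is called minimal if it has no non-empty proper subsum which is vanishing, i.e. if $\sum_{i\in I}z^{a_i}\neq0$ for every non-empty proper subset $I\subset\{1,\dots,l\}$. For $m\in\mathbb{Z}_{\geq1}$: $\lambda(s,m)$ is the number of entries of $s$ of (multiplicative) order $m$; $\tilde{\lambda}(s,m)$ is the number of different entries of $s$ of order $m$; $s^{(m)}$ is the subsum of $s$ consisting of all entries of $s$ of order $m$. $\mathbb{Q}_n$ denotes the $n$-th cyclotomic field, i.e. the smallest extension field of $\mathbb{Q}$ containing a primitive $n$-th root of unity. Further, $\mathbb{Q}(s):=\mathbb{Q}(|s|)$, and $f_s$ is the conductor of $|s|$, i.e. the smallest positive integer $f$ with $\mathbb{Q}(|s|)\subseteq\mathbb{Q}_f$.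
   Formalization: In (a), uniqueness fails for the class of value 0, since all rotations of the sum of the p-th roots of unity are minimal vanishing sums; there the minimal representative is also required not to be a non-empty vanishing sum, so it is the empty sum. *)

theory Defs
  imports
    Complex_Main
    "HOL-Library.Multiset"
    "HOL-Algebra.Generated_Fields"
    "HOL-Algebra.Algebraic_Closure_Type"
begin

text \<open>For \<open>m > 0\<close> this also says that \<open>x\<close> has multiplicative order \<open>m\<close>.\<close>

definition primitive_root_of_unity :: "nat \<Rightarrow> complex \<Rightarrow> bool" where
  "primitive_root_of_unity m x \<longleftrightarrow> m > 0 \<and> x ^ m = 1 \<and> (\<forall>j. 0 < j \<and> j < m \<longrightarrow> x ^ j \<noteq> 1)"

text \<open>
  Tuples of roots of unity are identified up to permutation, so a sum of roots of unity is a
  multiset of complex numbers; its length is \<^const>\<open>size\<close>, its value is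
  \<^const>\<open>sum_mset\<close> and its subsums are its submultisets. The empty sum is allowed: the
  subsum of entries of a given order may well be empty.
\<close>

definition root_sum :: "complex \<Rightarrow> int list \<Rightarrow> complex multiset" where
  "root_sum z a = mset (map (\<lambda>i. z powi i) a)"

definition root_sums :: "complex \<Rightarrow> complex multiset set" where
  "root_sums z = range (root_sum z)"

definition minimal_sum :: "complex multiset \<Rightarrow> bool" where
  "minimal_sum s \<longleftrightarrow> (\<forall>t. t \<subset># s \<and> t \<noteq> {#} \<longrightarrow> sum_mset t \<noteq> 0)"

definition same_value :: "complex \<Rightarrow> (complex multiset \<times> complex multiset) set" where
  "same_value z =
    {(s1, s2). s1 \<in> root_sums z \<and> s2 \<in> root_sums z \<and> sum_mset s1 = sum_mset s2}"

text \<open>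
  If the value of the class \<open>C\<close> is nonzero, the last conjunct is void and this is just a
  representative that is a minimal sum. The conjunct matters only for the class of value 0, where
  \<^const>\<open>minimal_sum\<close> alone does not determine the representative: besides the
  empty sum, every rotation of the sum of all \<open>p\<close>-th roots of unity is a minimal sum, because
  only proper subsums are tested. There the sum itself is required not to be a non-empty
  vanishing sum either.
\<close>

definition minimal_representative :: "complex multiset set \<Rightarrow> complex multiset \<Rightarrow> bool" where
  "minimal_representative C s \<longleftrightarrow>
    s \<in> C \<and> minimal_sum s \<and> (sum_mset s = 0 \<longrightarrow> s = {#})"

definition order_part :: "complex multiset \<Rightarrow> nat \<Rightarrow> complex multiset" where
  "order_part s m = filter_mset (primitive_root_of_unity m) s"

definition order_count :: "complex multiset \<Rightarrow> nat \<Rightarrow> nat" where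
  "order_count s m = size (order_part s m)"

definition distinct_order_count :: "complex multiset \<Rightarrow> nat \<Rightarrow> nat" where
  "distinct_order_count s m = card (set_mset (order_part s m))"

abbreviation complex_field :: "complex ring" where
  "complex_field \<equiv> ring_of_type_algebra"

text \<open>
  Every subfield of the complex numbers contains the rationals, so the subfield generated by
  \<open>x\<close> is the simple extension of the rationals by \<open>x\<close>.
\<close>

definition rat_adjoin :: "complex \<Rightarrow> complex set" where
  "rat_adjoin x = generate_field complex_field {x}"

definition cyclotomic_field :: "nat \<Rightarrow> complex set" where
  "cyclotomic_field n = rat_adjoin (cis (2 * pi / real n))"

definition sum_field :: "complex multiset \<Rightarrow> complex set" where
  "sum_field s = rat_adjoin (sum_mset s)"

definition conductor :: "complex multiset \<Rightarrow> nat" where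
  "conductor s = (LEAST f. f > 0 \<and> sum_field s \<subseteq> cyclotomic_field f)"

definition field_degree :: "complex set \<Rightarrow> complex set \<Rightarrow> nat" where
  "field_degree L K = ring.dim complex_field K L"

end

theory Submission
  imports Defs "HOL-Number_Theory.Residues"
begin

text \<open>
  The engine is Galois conjugation of cyclotomic numbers in its most elementary form: if a
  rational polynomial vanishes at \<open>w\<close>, where \<open>w ^ n = 1\<close>, then it vanishes at
  \<open>w ^ t\<close> for every \<open>t\<close> coprime to \<open>n\<close> (\<open>conjugate_root_rat\<close>). Hence
  \<open>f(w) \<mapsto> f(w ^ t)\<close> is a well-defined ring endomorphism of \<open>\<rat>[w]\<close>
  (\<open>galois_conj\<close>), and it raises every entry of a sum of powers of \<open>w\<close> to the power
  \<open>t\<close>. In this overview \<open>q\<close> stands for \<open>p ^ (k - 1)\<close>.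

  Averaging. Let \<open>N > 0\<close> be a multiple of \<open>q\<close> but not of \<open>p ^ k\<close>. The exponents
  \<open>1 + u * N\<close> with \<open>u < p\<close> multiply an entry \<open>x\<close> by the powers of \<open>x ^ N\<close>, which is
  \<open>1\<close> if \<open>x\<close> has order less than \<open>p ^ k\<close> and a primitive \<open>p\<close>-th root of unity
  otherwise. So the sum of the \<open>p\<close> conjugates of \<open>|s|\<close> is \<open>p\<close> times the value of the
  entries of order less than \<open>p ^ k\<close>: the full-order entries average out
  (\<open>galois_conj_order_part\<close>). Thus \<open>|s|\<close> determines the value of the full-order part, which is
  the last claim of (a). Moreover a value in the \<open>N\<close>-th cyclotomic field is fixed by these
  conjugations, so its full-order part vanishes (\<open>order_part_eq_0_if_mem_cyclotomic_field\<close>).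
  If \<open>|s|\<close> lies in the \<open>f\<close>-th cyclotomic field with \<open>f < p ^ k\<close>, it also lies in the
  \<open>N\<close>-th one for \<open>N = q * m\<close>, where \<open>m\<close> is the part of \<open>f\<close> prime to \<open>p\<close>;
  this gives the conductor (\<open>conductor_eq_iff\<close>).

  Vanishing sums. If two sums have equal values, so have their conjugates; Fourier inversion on
  the group of \<open>p ^ k\<close>-th roots of unity then shows that the difference of their
  multiplicities is constant on the cosets of the \<open>p\<close>-th roots of unity
  (\<open>count_diff_invariant\<close>). A sum without non-empty vanishing subsum contains no full coset,
  so two such sums with the same value coincide (\<open>subset_mset_of_vanishing_free\<close>). The same
  invariance makes both entry counts of a vanishing full-order part divisible by \<open>p\<close>
  (\<open>prime_dvd_order_counts\<close>), which is the source of both `in particular' clauses.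

  Degree. The degree of the \<open>p ^ k\<close>-th cyclotomic field over \<open>\<rat>(|s|)\<close> is the degree of
  the minimal polynomial of \<open>\<zeta> = exp(2 \<pi> i / p ^ k)\<close>, whose roots are simple and are the
  \<open>\<zeta> ^ t\<close> such that conjugation by \<open>t\<close> fixes \<open>|s|\<close>
  (\<open>field_degree_eq_card_conjugates\<close>). If the full-order part vanishes, \<open>|s|\<close> is a
  polynomial in \<open>\<zeta> ^ p\<close>, so multiplication by \<open>p\<close>-th roots of unity permutes these roots
  and \<open>p\<close> divides their number. If it does not vanish, the roots are told apart by
  \<open>t mod p\<close>, so there are fewer than \<open>p\<close> of them: otherwise the exponents fixing \<open>|s|\<close>
  would contain some \<open>r \<noteq> 1\<close> with \<open>r \<equiv> 1 (mod p)\<close>, a power of which is congruent to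
  \<open>1\<close> modulo \<open>q\<close> but not modulo \<open>p ^ k\<close> (here \<open>p\<close> is odd), and then all
  \<open>1 + v * q\<close> would fix \<open>|s|\<close>, against the averaging argument.
\<close>

section \<open>Conjugate roots of integer polynomials\<close>

lemma prime_dvd_power_add_diff:
  fixes a b :: "'a::comm_ring_1"
  assumes "Factorial_Ring.prime q"
  shows "of_nat q dvd (a + b) ^ q - a ^ q - b ^ q"
proof -
  have q: "q \<ge> 1" using assms prime_ge_1_nat by blast
  let ?f = "\<lambda>j. of_nat (q choose j) * a ^ j * b ^ (q - j)"
  have "(a + b) ^ q = (\<Sum>j\<le>q. ?f j)"
    by (rule binomial_ring)
  also have "{..q} = insert 0 (insert q {1..<q})"
    using q by auto
  also have "sum ?f \<dots> = b ^ q + a ^ q + sum ?f {1..<q}"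
    using q by (subst sum.insert; (subst sum.insert)?; simp)
  finally have "(a + b) ^ q - a ^ q - b ^ q = sum ?f {1..<q}"
    by simp
  moreover have "of_nat q dvd ?f j" if "j \<in> {1..<q}" for j
  proof -
    have "q dvd (q choose j)"
      using that assms by (intro dvd_choose_prime) auto
    then obtain c where "q choose j = q * c" by (elim dvdE)
    hence "?f j = of_nat q * (of_nat c * a ^ j * b ^ (q - j))"
      by (simp add: mult.assoc)
    thus ?thesis by (metis dvd_triv_left)
  qed
  ultimately show ?thesis
    using dvd_sum[of "{1..<q}" "of_nat q" ?f] by simp
qed

lemma int_fermat_little:
  assumes "Factorial_Ring.prime q"
  shows "int q dvd a ^ q - a"
proof -
  have q: "q \<ge> 1" using assms prime_ge_1_nat by blast
  have step: "int q dvd ((a + 1) ^ q - (a + 1)) - (a ^ q - a)" for a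
    using prime_dvd_power_add_diff[OF assms, of a 1] by (simp add: algebra_simps)
  show ?thesis
  proof (induction a rule: int_induct[of _ 0])
    case base
    then show ?case using q by (simp add: zero_power)
  next
    case (step1 i)
    then show ?case using dvd_add[OF step1.IH step[of i]] by (simp add: algebra_simps)
  next
    case (step2 i)
    then show ?case using dvd_diff[OF step2.IH step[of "i - 1"]] by (simp add: algebra_simps)
  qed
qed

text \<open>
  The identity \<open>f(X ^ q) \<equiv> f(X) ^ q (mod q)\<close>, stated over the integers so that it can be
  evaluated at a complex number.
\<close>
lemma int_poly_frobenius:
  fixes f :: "int poly"
  assumes "Factorial_Ring.prime q"
  shows "of_nat q dvd pcompose f (monom 1 q) - f ^ q"
proof (induction f)
  case 0
  then show ?case using prime_gt_0_nat[OF assms] by (simp add: zero_power)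
next
  case (pCons a f)
  let ?X = "monom 1 q :: int poly"
  define E where "E = ([:a:] + pCons 0 f) ^ q - [:a:] ^ q - pCons 0 f ^ q"
  have E: "of_nat q dvd E"
    unfolding E_def by (rule prime_dvd_power_add_diff[OF assms])
  have x: "pCons 0 f ^ q = ?X * f ^ q"
  proof -
    have "pCons 0 f = monom 1 1 * f" by (simp add: monom_altdef)
    thus ?thesis by (simp add: power_mult_distrib monom_power)
  qed
  have a: "[:a:] ^ q = [:a ^ q:]" by (simp add: poly_const_pow)
  have "of_nat q dvd [:a - a ^ q:]"
  proof -
    have "int q dvd a - a ^ q" using int_fermat_little[OF assms, of a] by (simp add: dvd_diff_commute)
    then obtain c where "a - a ^ q = int q * c" by (elim dvdE)
    hence "[:a - a ^ q:] = of_nat q * [:c:]" by (simp add: of_nat_poly)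
    thus ?thesis by (metis dvd_triv_left)
  qed
  moreover have "pcompose (pCons a f) ?X - pCons a f ^ q =
      [:a - a ^ q:] + ?X * (pcompose f ?X - f ^ q) - E"
  proof -
    have "pCons a f = [:a:] + pCons 0 f" by simp
    hence "pCons a f ^ q = E + [:a ^ q:] + ?X * f ^ q"
      unfolding E_def x a by (simp add: algebra_simps)
    moreover have "[:a - a ^ q:] = [:a:] - [:a ^ q:]" by simp
    ultimately show ?thesis by (simp only: pcompose_pCons) (simp add: algebra_simps)
  qed
  ultimately show ?case
    using pCons.IH E by (auto intro!: dvd_add dvd_diff)
qed

definition int_poly_value :: "int poly \<Rightarrow> complex \<Rightarrow> complex" where
  "int_poly_value f x = poly (map_poly of_int f) x"

lemma int_poly_value_add [simp]:
  "int_poly_value (f + g) x = int_poly_value f x + int_poly_value g x"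
proof -
  have "map_poly of_int (f + g) = map_poly of_int f + (map_poly of_int g :: complex poly)"
    by (simp add: poly_eq_iff coeff_map_poly)
  thus ?thesis by (simp add: int_poly_value_def)
qed

lemma int_poly_value_mult [simp]:
  "int_poly_value (f * g) x = int_poly_value f x * int_poly_value g x"
proof -
  have "map_poly of_int (f * g) = map_poly of_int f * (map_poly of_int g :: complex poly)"
    by (simp add: poly_eq_iff coeff_map_poly coeff_mult)
  thus ?thesis by (simp add: int_poly_value_def)
qed

lemma int_poly_value_simps [simp]:
  "int_poly_value 0 x = 0"
  "int_poly_value 1 x = 1"
  "int_poly_value (monom 1 j) x = x ^ j"
  "int_poly_value [:c:] x = of_int c"
  "int_poly_value (pCons c f) x = of_int c + x * int_poly_value f x"
  by (simp_all add: int_poly_value_def map_poly_monom poly_monom map_poly_pCons)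

lemma int_poly_value_uminus [simp]: "int_poly_value (- f) x = - int_poly_value f x"
  using int_poly_value_add[of f "- f" x] by (simp add: add_eq_0_iff2 del: int_poly_value_add)

lemma int_poly_value_diff [simp]:
  "int_poly_value (f - g) x = int_poly_value f x - int_poly_value g x"
  using int_poly_value_add[of f "- g" x] by (simp del: int_poly_value_add)

lemma int_poly_value_power [simp]: "int_poly_value (f ^ j) x = int_poly_value f x ^ j"
  by (induction j) simp_all

lemma int_poly_value_smult [simp]: "int_poly_value (smult c f) x = of_int c * int_poly_value f x"
  using int_poly_value_mult[of "[:c:]" f x] by simp

lemma int_poly_value_of_nat [simp]: "int_poly_value (of_nat c) x = of_nat c"
  by (simp add: of_nat_poly)

lemma int_poly_value_pcompose [simp]:
  "int_poly_value (pcompose f g) x = int_poly_value f (int_poly_value g x)"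
  by (induction f) (simp_all add: pcompose_pCons)

text \<open>
  A polynomial of least degree vanishing at \<open>w\<close>, made primitive. Pseudo-division shows that it
  divides a multiple \<open>a * P\<close> of any other such \<open>P\<close>, and Gauss's lemma removes \<open>a\<close>.
\<close>
lemma minimal_int_polynomial:
  fixes w :: complex and P0 :: "int poly"
  assumes "P0 \<noteq> 0" "int_poly_value P0 w = 0"
  obtains f :: "int poly" where "f \<noteq> 0" "int_poly_value f w = 0"
    "\<And>P. int_poly_value P w = 0 \<Longrightarrow> f dvd P"
    "\<And>P. int_poly_value P w = 0 \<Longrightarrow> degree P < degree f \<Longrightarrow> P = 0"
proof -
  define Z where "Z = (\<lambda>P :: int poly. P \<noteq> 0 \<and> int_poly_value P w = 0)"
  define f0 where "f0 = arg_min degree Z"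
  have f0: "Z f0" and min: "\<And>P. Z P \<Longrightarrow> degree f0 \<le> degree P"
    using arg_min_nat_lemma[of Z P0 degree] assms unfolding f0_def Z_def by auto
  define f where "f = primitive_part f0"
  have fz: "f \<noteq> 0" "degree f = degree f0" and cf: "content f = 1"
    using f0 by (auto simp: f_def Z_def)
  have "f0 = smult (content f0) f" by (simp add: f_def)
  hence "of_int (content f0) * int_poly_value f w = 0"
    using f0 int_poly_value_smult[of "content f0" f w] unfolding Z_def by simp
  hence root: "int_poly_value f w = 0"
    using f0 by (auto simp: Z_def)
  have small: "P = 0" if "int_poly_value P w = 0" "degree P < degree f" for P
    using min[of P] that fz by (auto simp: Z_def)
  have dvd: "f dvd P" if P: "int_poly_value P w = 0" for P
  proof -
    obtain a h where ah: "a \<noteq> 0" "smult a P = f * h + pseudo_mod P f"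
      using pseudo_mod(1)[OF fz(1), of P] by blast
    have "int_poly_value (pseudo_mod P f) w = int_poly_value (smult a P - f * h) w"
      using ah(2) by simp
    also have "\<dots> = 0" using P root by simp
    finally have "pseudo_mod P f = 0"
      using pseudo_mod(2)[OF fz(1), of P] small by blast
    hence eq: "smult a P = f * h" using ah by simp
    have "f dvd primitive_part (smult a P)"
      unfolding eq primitive_part_mult using cf by (simp add: primitive_part_prim)
    hence "f dvd smult (unit_factor a) (primitive_part P)"
      by (simp add: primitive_part_smult)
    hence "f dvd primitive_part P"
      using ah(1) by (cases "a > 0") (auto simp: sgn_if)
    thus "f dvd P"
      by (metis content_times_primitive_part dvd_smult)
  qed
  show ?thesis by (rule that[OF fz(1) root dvd small])
qed

text \<open>
  Differentiating \<open>X ^ n - 1 = f g\<close> at a root of \<open>g\<close>: the value of \<open>f\<close> there divides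
  \<open>n\<close>, with a quotient that is an integer polynomial in the root.
\<close>
lemma order_eq_value_times_pderiv_cofactor:
  assumes "n > 0" "monom 1 n - 1 = f * g" "w ^ n = 1" "int_poly_value g w = 0"
  shows "of_nat n = w * int_poly_value f w * int_poly_value (pderiv g) w"
proof -
  have "pderiv (monom 1 n - 1 :: int poly) = pderiv f * g + f * pderiv g"
    unfolding assms(2) by (simp add: pderiv_mult)
  hence "int_poly_value (pderiv (monom 1 n - 1)) w = int_poly_value f w * int_poly_value (pderiv g) w"
    using assms(4) by simp
  moreover have "pderiv (monom 1 n - 1 :: int poly) = smult (int n) (monom 1 (n - 1))"
    by (simp add: pderiv_diff pderiv_monom smult_monom)
  ultimately have "of_nat n * w ^ (n - 1) = int_poly_value f w * int_poly_value (pderiv g) w"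
    by simp
  hence "of_nat n * (w * w ^ (n - 1)) = w * int_poly_value f w * int_poly_value (pderiv g) w"
    by (simp only: mult_ac)
  moreover have "w * w ^ (n - 1) = 1"
    using assms(1,3) by (cases n) simp_all
  ultimately show ?thesis by (simp only: mult_1_right)
qed

text \<open>
  Dedekind's argument without reduction modulo \<open>q\<close>. Let \<open>f\<close> be the minimal polynomial of
  \<open>w\<close>, with \<open>X ^ n - 1 = f g\<close>, and suppose \<open>f(w ^ q) \<noteq> 0\<close>. The Frobenius congruence
  makes \<open>f(w ^ q)\<close> divisible by \<open>q\<close> in \<open>\<int>[w]\<close>. On the other hand \<open>g(w ^ q) = 0\<close>, so
  \<open>f(w ^ q)\<close> divides \<open>n\<close> by the previous lemma. Hence \<open>n = q * v(w)\<close>; as the leading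
  coefficient of \<open>f\<close> is a unit, \<open>v\<close> can be reduced modulo \<open>f\<close>, and comparing constant
  terms gives \<open>q dvd n\<close>.
\<close>
lemma conjugate_root_prime:
  fixes w :: complex and P :: "int poly"
  assumes n: "n > 0" and w: "w ^ n = 1" and q: "Factorial_Ring.prime q" and "\<not> q dvd n"
    and P: "int_poly_value P w = 0"
  shows "int_poly_value P (w ^ q) = 0"
proof -
  let ?U = "monom 1 n - 1 :: int poly"
  have U0: "?U \<noteq> 0"
    using n by (auto simp: poly_eq_iff intro!: exI[of _ n])
  obtain f where f: "f \<noteq> 0" "int_poly_value f w = 0"
    and fdvd: "\<And>P. int_poly_value P w = 0 \<Longrightarrow> f dvd P"
    and fmin: "\<And>P. int_poly_value P w = 0 \<Longrightarrow> degree P < degree f \<Longrightarrow> P = 0"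
    using minimal_int_polynomial[of ?U w] U0 w by auto
  have degf: "degree f > 0"
  proof (rule ccontr)
    assume "\<not> degree f > 0"
    then obtain c where "f = [:c:]" by (auto elim: degree_eq_zeroE)
    thus False using f by simp
  qed
  obtain g where g: "?U = f * g"
    using fdvd[of ?U] w by (auto elim: dvdE)
  have "lead_coeff ?U = 1"
  proof -
    have "degree (1 :: int poly) < degree (monom 1 n :: int poly)"
      using n by (simp add: degree_monom_eq)
    hence "degree ?U = n"
      by (simp add: degree_monom_eq diff_conv_add_uminus degree_add_eq_left del: add_uminus_conv_diff)
    thus ?thesis using n by simp
  qed
  hence lc: "lead_coeff f dvd 1"
    using g by (metis dvd_triv_left lead_coeff_mult)
  have "int_poly_value f (w ^ q) = 0"
  proof (rule ccontr)
    assume nz: "int_poly_value f (w ^ q) \<noteq> 0"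
    have "(w ^ q) ^ n = 1" using w by (metis power_mult mult.commute power_one)
    hence "int_poly_value ?U (w ^ q) = 0" by simp
    hence gz: "int_poly_value g (w ^ q) = 0"
      unfolding g using nz by simp
    obtain h where h: "pcompose f (monom 1 q) - f ^ q = of_nat q * h"
      using int_poly_frobenius[OF q, of f] by (elim dvdE)
    have "int_poly_value f (w ^ q) = int_poly_value (pcompose f (monom 1 q) - f ^ q) w"
      using f(2) prime_gt_0_nat[OF q] by simp
    hence fq: "int_poly_value f (w ^ q) = of_nat q * int_poly_value h w"
      unfolding h by simp
    define v where "v = monom 1 q * h * pcompose (pderiv g) (monom 1 q)"
    have nv: "of_nat n = of_nat q * int_poly_value v w"
      using order_eq_value_times_pderiv_cofactor[OF n g \<open>(w ^ q) ^ n = 1\<close> gz]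
      unfolding fq v_def by (simp add: mult_ac)
    obtain b r where br: "pseudo_divmod v f = (b, r)" by force
    \<comment> \<open>the factor introduced by pseudo-division; it is a unit because \<open>lead_coeff f\<close> is\<close>
    define c where "c = lead_coeff f ^ (Suc (degree v) - degree f)"
    have vr: "smult c v = f * b + r" and rdeg: "r = 0 \<or> degree r < degree f"
      using pseudo_divmod[OF f(1) br] unfolding c_def by auto
    have "of_int c * int_poly_value v w = int_poly_value r w"
      using arg_cong[OF vr, of "\<lambda>p. int_poly_value p w"] f(2) by simp
    hence "int_poly_value ([:c * int n:] - smult (int q) r) w = 0"
      using nv by (simp add: mult.left_commute)
    moreover have "degree ([:c * int n:] - smult (int q) r) < degree f"
      using rdeg degf by (intro degree_diff_less) auto
    ultimately have "[:c * int n:] = smult (int q) r"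
      using fmin by fastforce
    hence "c * int n = int q * coeff r 0"
      by (metis coeff_pCons_0 coeff_smult)
    hence "int q dvd c * int n" by simp
    moreover have "c dvd 1" unfolding c_def using lc by (metis dvd_power_same power_one)
    ultimately have "int q dvd int n"
      using dvd_mult_unit_iff' by blast
    thus False using assms(4) by simp
  qed
  thus ?thesis using fdvd[OF P] by (auto elim!: dvdE)
qed

text \<open>A general exponent is reached one prime factor at a time.\<close>
lemma conjugate_root:
  fixes w :: complex and P :: "int poly"
  assumes n: "n > 0" and w: "w ^ n = 1" and "coprime t n" and P: "int_poly_value P w = 0"
  shows "int_poly_value P (w ^ t) = 0"
proof (cases "t = 0")
  case True
  hence "n = 1" using assms by simp
  thus ?thesis using w P True by simp
next
  case False
  thus ?thesis using w P \<open>coprime t n\<close>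
  proof (induction t arbitrary: w rule: prime_divisors_induct)
    case zero
    then show ?case by simp
  next
    case (unit t)
    then show ?case by simp
  next
    case (factor q t)
    have "\<not> q dvd n"
      using factor.hyps factor.prems(4)
      by (metis coprime_common_divisor dvd_triv_left not_prime_unit)
    hence "int_poly_value P (w ^ q) = 0"
      using conjugate_root_prime[OF n] factor by blast
    moreover have "(w ^ q) ^ n = 1" using factor.prems by (metis power_mult mult.commute power_one)
    ultimately show ?case
      using factor.IH[of "w ^ q"] factor.prems by (simp add: power_mult)
  qed
qed

section \<open>Galois conjugation on the rational polynomials in a root of unity\<close>
definition rat_poly_value :: "rat poly \<Rightarrow> complex \<Rightarrow> complex" where
  "rat_poly_value f x = poly (map_poly of_rat f) x"

lemma rat_poly_value_add [simp]:
  "rat_poly_value (f + g) x = rat_poly_value f x + rat_poly_value g x"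
proof -
  have "map_poly of_rat (f + g) = map_poly of_rat f + (map_poly of_rat g :: complex poly)"
    by (simp add: poly_eq_iff coeff_map_poly of_rat_add)
  thus ?thesis by (simp add: rat_poly_value_def)
qed

lemma rat_poly_value_mult [simp]:
  "rat_poly_value (f * g) x = rat_poly_value f x * rat_poly_value g x"
proof -
  have "map_poly of_rat (f * g) = map_poly of_rat f * (map_poly of_rat g :: complex poly)"
    by (simp add: poly_eq_iff coeff_map_poly coeff_mult of_rat_sum of_rat_mult)
  thus ?thesis by (simp add: rat_poly_value_def)
qed

lemma rat_poly_value_simps [simp]:
  "rat_poly_value 0 x = 0"
  "rat_poly_value 1 x = 1"
  "rat_poly_value (monom 1 j) x = x ^ j"
  "rat_poly_value (pCons c f) x = of_rat c + x * rat_poly_value f x"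
  by (simp_all add: rat_poly_value_def map_poly_monom poly_monom map_poly_pCons)

lemma rat_poly_value_uminus [simp]: "rat_poly_value (- f) x = - rat_poly_value f x"
  using rat_poly_value_add[of f "- f" x] by (simp add: add_eq_0_iff2 del: rat_poly_value_add)

lemma rat_poly_value_diff [simp]:
  "rat_poly_value (f - g) x = rat_poly_value f x - rat_poly_value g x"
  using rat_poly_value_add[of f "- g" x] by (simp del: rat_poly_value_add)

lemma rat_poly_value_smult [simp]: "rat_poly_value (smult c f) x = of_rat c * rat_poly_value f x"
  using rat_poly_value_mult[of "[:c:]" f x] by simp

lemma rat_poly_value_pcompose [simp]:
  "rat_poly_value (pcompose f g) x = rat_poly_value f (rat_poly_value g x)"
  by (induction f) (simp_all add: pcompose_pCons)

lemma rat_poly_value_of_int_poly: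
  "rat_poly_value (map_poly of_int f) x = int_poly_value f x"
  by (induction f) (simp_all add: map_poly_pCons)

lemma rat_poly_clear_denominators:
  fixes f :: "rat poly"
  obtains d :: int and g :: "int poly" where "d \<noteq> 0" "smult (of_int d) f = map_poly of_int g"
proof -
  have "\<exists>d g. d \<noteq> 0 \<and> smult (of_int d) f = map_poly of_int (g :: int poly)"
  proof (induction f)
    case 0
    show ?case by (rule exI[of _ 1], rule exI[of _ 0]) simp
  next
    case (pCons c f)
    then obtain d g where dg: "d \<noteq> 0" "smult (of_int d) f = map_poly of_int g" by blast
    have ab: "c = of_int (fst (quotient_of c)) / of_int (snd (quotient_of c))"
        "snd (quotient_of c) \<noteq> 0" for c :: rat
      using quotient_of_denom_pos'[of c] quotient_of_div[of c] by (auto simp: prod_eq_iff)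
    define a b where "a = fst (quotient_of c)" and "b = snd (quotient_of c)"
    have ab: "c = of_int a / of_int b" "b \<noteq> 0"
      unfolding a_def b_def by (fact ab)+
    have "smult (of_int (d * b)) (pCons c f) = pCons (of_int (d * a)) (smult (of_int b) (smult (of_int d) f))"
      using ab by (simp add: mult.commute)
    also have "\<dots> = map_poly of_int (pCons (d * a) (smult b g))"
      by (simp add: dg map_poly_pCons map_poly_smult)
    finally have "smult (of_int (d * b)) (pCons c f) = map_poly of_int (pCons (d * a) (smult b g))" .
    moreover have "d * b \<noteq> 0" using dg ab by simp
    ultimately show ?case by (intro exI[of _ "d * b"] exI[of _ "pCons (d * a) (smult b g)"]) simp
  qed
  thus ?thesis using that by blast
qed

lemma conjugate_root_rat:
  fixes w :: complex
  assumes "n > 0" "w ^ n = 1" "coprime t n" "rat_poly_value f w = 0"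
  shows "rat_poly_value f (w ^ t) = 0"
proof -
  obtain d g where dg: "d \<noteq> 0" "smult (of_int d) f = map_poly of_int g"
    by (rule rat_poly_clear_denominators)
  have eq: "of_int d * rat_poly_value f x = int_poly_value g x" for x
    using arg_cong[OF dg(2), of "\<lambda>h. rat_poly_value h x"] by (simp add: rat_poly_value_of_int_poly)
  have "int_poly_value g (w ^ t) = 0"
    using conjugate_root[OF assms(1-3), of g] eq[of w] assms(4) by simp
  thus ?thesis using eq[of "w ^ t"] dg by simp
qed

definition rat_polys_at :: "complex \<Rightarrow> complex set" where
  "rat_polys_at w = range (\<lambda>f. rat_poly_value f w)"

lemma rat_poly_value_mem [intro]: "rat_poly_value f w \<in> rat_polys_at w"
  by (simp add: rat_polys_at_def)

lemma rat_polys_at_add: "x \<in> rat_polys_at w \<Longrightarrow> y \<in> rat_polys_at w \<Longrightarrow> x + y \<in> rat_polys_at w"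
  unfolding rat_polys_at_def by (auto simp flip: rat_poly_value_add)

lemma rat_polys_at_mult: "x \<in> rat_polys_at w \<Longrightarrow> y \<in> rat_polys_at w \<Longrightarrow> x * y \<in> rat_polys_at w"
  unfolding rat_polys_at_def by (auto simp flip: rat_poly_value_mult)

lemma power_mem_rat_polys_at: "w ^ j \<in> rat_polys_at w"
  using rat_poly_value_mem[of "monom 1 j" w] by simp

lemma rat_mem_rat_polys_at: "of_rat c \<in> rat_polys_at w"
  using rat_poly_value_mem[of "[:c:]" w] by simp

lemma rat_polys_at_sum_mset:
  "(\<And>x. x \<in># s \<Longrightarrow> x \<in> rat_polys_at w) \<Longrightarrow> sum_mset s \<in> rat_polys_at w"
  by (induction s) (auto intro: rat_polys_at_add simp: rat_mem_rat_polys_at[of 0, simplified])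

text \<open>
  The automorphism \<open>w \<mapsto> w ^ t\<close> of \<open>\<rat>[w]\<close>, written through an arbitrary polynomial
  representing the argument. It is meaningful on \<open>rat_polys_at w\<close> when \<open>w\<close> is a root of
  unity whose order is coprime to \<open>t\<close>; \<open>galois_conj_value\<close> is the independence of the choice.
\<close>
definition galois_conj :: "complex \<Rightarrow> nat \<Rightarrow> complex \<Rightarrow> complex" where
  "galois_conj w t x = rat_poly_value (SOME f. rat_poly_value f w = x) (w ^ t)"

context
  fixes w :: complex and n t :: nat
  assumes n: "n > 0" and w: "w ^ n = 1" and t: "coprime t n"
begin

lemma galois_conj_value: "galois_conj w t (rat_poly_value f w) = rat_poly_value f (w ^ t)"
proof -
  define g where "g = (SOME g. rat_poly_value g w = rat_poly_value f w)"
  have "rat_poly_value g w = rat_poly_value f w"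
    unfolding g_def by (rule someI_ex) auto
  hence "rat_poly_value (g - f) (w ^ t) = 0"
    by (intro conjugate_root_rat[OF n w t]) simp
  thus ?thesis by (simp add: galois_conj_def g_def)
qed

lemma galois_conj_add:
  "x \<in> rat_polys_at w \<Longrightarrow> y \<in> rat_polys_at w \<Longrightarrow>
    galois_conj w t (x + y) = galois_conj w t x + galois_conj w t y"
  unfolding rat_polys_at_def
  by (auto simp: galois_conj_value simp flip: rat_poly_value_add)

lemma galois_conj_mult:
  "x \<in> rat_polys_at w \<Longrightarrow> y \<in> rat_polys_at w \<Longrightarrow>
    galois_conj w t (x * y) = galois_conj w t x * galois_conj w t y"
  unfolding rat_polys_at_def
  by (auto simp: galois_conj_value simp flip: rat_poly_value_mult)

lemma galois_conj_rat [simp]: "galois_conj w t (of_rat c) = of_rat c"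
  using galois_conj_value[of "[:c:]"] by simp

lemma galois_conj_power: "galois_conj w t (w ^ j) = (w ^ j) ^ t"
  using galois_conj_value[of "monom 1 j"] by (simp add: power_mult[symmetric] mult.commute)

lemma galois_conj_sum_mset:
  assumes "\<And>x. x \<in># s \<Longrightarrow> \<exists>j. x = w ^ j"
  shows "galois_conj w t (sum_mset s) = (\<Sum>x\<in>#s. x ^ t)"
  using assms
proof (induction s)
  case empty
  show ?case using galois_conj_rat[of 0] by simp
next
  case (add x s)
  obtain j where j: "x = w ^ j" using add.prems[of x] by auto
  have "sum_mset s \<in> rat_polys_at w"
    using add.prems by (intro rat_polys_at_sum_mset) (force intro: power_mem_rat_polys_at)
  hence "galois_conj w t (x + sum_mset s) = galois_conj w t x + galois_conj w t (sum_mset s)"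
    by (intro galois_conj_add) (auto simp: j power_mem_rat_polys_at)
  thus ?case using add by (simp add: j galois_conj_power)
qed

end

section \<open>Subfields of the complex numbers and minimal polynomials\<close>
lemma field_complex_field: "field complex_field"
  by (rule field_from_type_algebra)

interpretation CF: domain complex_field
  using field_complex_field by (rule field.axioms(1))

lemma complex_field_simps [simp]:
  "carrier complex_field = UNIV" "x \<otimes>\<^bsub>complex_field\<^esub> y = x * y" "\<one>\<^bsub>complex_field\<^esub> = 1"
  "\<zero>\<^bsub>complex_field\<^esub> = 0" "x \<oplus>\<^bsub>complex_field\<^esub> y = x + y"
  by (simp_all add: ring_of_type_algebra_def)

lemma complex_field_a_inv [simp]: "a_inv complex_field x = - x"
  using CF.minus_equality[of "- x" x] by simp

lemma complex_field_m_inv [simp]: "x \<noteq> 0 \<Longrightarrow> m_inv complex_field x = inverse x"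
  using CF.inv_unique'[of x "inverse x"] by simp

lemma complex_field_nat_pow [simp]: "x [^]\<^bsub>complex_field\<^esub> (j :: nat) = x ^ j"
  by (induction j) (simp_all add: mult.commute)

lemma subfield_rat_adjoin: "subfield (rat_adjoin x) complex_field"
  unfolding rat_adjoin_def by (rule field.generate_field_is_subfield[OF field_complex_field]) simp

lemma rat_adjoin_self: "x \<in> rat_adjoin x"
  unfolding rat_adjoin_def by (rule generate_field.incl) simp

lemma rat_adjoin_least:
  "subfield E complex_field \<Longrightarrow> x \<in> E \<Longrightarrow> rat_adjoin x \<subseteq> E"
  unfolding rat_adjoin_def by (rule field.generate_field_min_subfield1[OF field_complex_field]) auto

lemma rat_adjoin_subset_iff: "rat_adjoin x \<subseteq> rat_adjoin y \<longleftrightarrow> x \<in> rat_adjoin y"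
  using rat_adjoin_self rat_adjoin_least[OF subfield_rat_adjoin] by blast

lemma subfield_complex_closed:
  assumes "subfield E complex_field"
  shows "0 \<in> E" "1 \<in> E" "x \<in> E \<Longrightarrow> y \<in> E \<Longrightarrow> x + y \<in> E" "x \<in> E \<Longrightarrow> y \<in> E \<Longrightarrow> x * y \<in> E"
    "x \<in> E \<Longrightarrow> - x \<in> E" "x \<in> E \<Longrightarrow> inverse x \<in> E"
proof -
  have E: "subring E complex_field" using assms by (rule subfieldE(1))
  show "0 \<in> E" using subringE(2)[OF E] by simp
  show "1 \<in> E" using subringE(3)[OF E] by simp
  show "x + y \<in> E" if "x \<in> E" "y \<in> E" using subringE(7)[OF E] that by simp
  show "x * y \<in> E" if "x \<in> E" "y \<in> E" using subringE(6)[OF E] that by simp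
  show "- x \<in> E" if "x \<in> E" using subringE(5)[OF E] that by simp
  show "inverse x \<in> E" if "x \<in> E"
    using CF.subfield_m_inv(1)[OF assms, of x] that \<open>0 \<in> E\<close> by (cases "x = 0") auto
qed

lemma subfield_complex_rat:
  assumes "subfield E complex_field"
  shows "of_rat c \<in> E"
proof -
  note cl = subfield_complex_closed[OF assms]
  have nat: "of_nat j \<in> E" for j by (induction j) (auto intro: cl)
  have int: "of_int i \<in> E" for i
    by (cases i rule: int_cases2) (auto intro: cl nat)
  obtain a b where "c = of_int a / of_int b"
    by (metis quotient_of_div surj_pair)
  hence "of_rat c = of_int a * inverse (of_int b :: complex)"
    by (simp add: of_rat_mult of_rat_inverse divide_inverse)
  thus ?thesis by (auto intro: cl int)
qed

lemma subfield_complex_rat_poly_value: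
  assumes "subfield E complex_field" "x \<in> E"
  shows "rat_poly_value f x \<in> E"
  using assms(2) by (induction f)
    (auto intro: subfield_complex_closed[OF assms(1)] subfield_complex_rat[OF assms(1)])

lemma subfield_complex_power:
  assumes "subfield E complex_field" "x \<in> E"
  shows "x ^ j \<in> E"
  using assms(2) by (induction j) (auto intro: subfield_complex_closed[OF assms(1)])

lemma subfield_complex_sum_mset:
  assumes "subfield E complex_field" "\<And>x. x \<in># s \<Longrightarrow> x \<in> E"
  shows "sum_mset s \<in> E"
  using assms(2) by (induction s) (auto intro: subfield_complex_closed[OF assms(1)])

text \<open>
  The polynomials of the extension field theory are coefficient lists with leading coefficient
  first; the next two lemmas translate them to and from the type of polynomials.
\<close>
lemma eval_eq_poly: "CF.eval l x = poly (Poly (rev l)) x"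
  by (induction l) (simp_all add: Poly_snoc poly_monom)

lemma rev_coeffs_mem_univ_poly:
  assumes "\<And>i. Polynomial.coeff q i \<in> K"
  shows "rev (coeffs q) \<in> carrier (univ_poly complex_field K)"
proof (cases "q = 0")
  case False
  hence "coeffs q \<noteq> []" by simp
  moreover have "set (coeffs q) \<subseteq> K"
    using assms by (auto simp: coeffs_def)
  ultimately show ?thesis using False
    by (simp add: univ_poly_def polynomial_def hd_rev last_coeffs_eq_coeff_degree)
qed (simp add: univ_poly_def polynomial_def)

lemma root_of_unity_algebraic:
  assumes K: "subfield K complex_field" and n: "n > 0" and z: "z ^ n = 1"
  shows "(CF.algebraic over K) z"
proof (rule CF.algebraicI)
  let ?q = "monom 1 n - 1 :: complex poly"
  show "rev (coeffs ?q) \<in> carrier (univ_poly complex_field K)"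
    by (rule rev_coeffs_mem_univ_poly)
       (auto simp: coeff_1 intro!: subfield_complex_closed[OF K] simp flip: add_uminus_conv_diff)
  have "?q \<noteq> 0" using n by (auto simp: poly_eq_iff intro!: exI[of _ n])
  thus "rev (coeffs ?q) \<noteq> []" by simp
  show "CF.eval (rev (coeffs ?q)) z = \<zero>\<^bsub>complex_field\<^esub>"
    using z by (simp add: eval_eq_poly poly_monom)
qed

lemma subfield_Rats: "subfield \<rat> complex_field"
proof (rule field.subfieldI'[OF field_complex_field CF.subringI])
qed auto

text \<open>
  Since \<open>w\<close> is algebraic, \<open>\<rat>[w]\<close> is already a field, so that conjugation is defined on all
  of \<open>\<rat>(w)\<close>.
\<close>
lemma rat_adjoin_root_of_unity:
  assumes n: "n > 0" and w: "w ^ n = 1"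
  shows "rat_adjoin w = rat_polys_at w"
proof
  show "rat_polys_at w \<subseteq> rat_adjoin w"
    unfolding rat_polys_at_def
    using subfield_complex_rat_poly_value[OF subfield_rat_adjoin rat_adjoin_self] by auto
  have "subfield (CF.simple_extension \<rat> w) complex_field"
    using CF.simple_extension_is_subfield[OF subfield_Rats, of w]
      root_of_unity_algebraic[OF subfield_Rats n w] by simp
  hence "rat_adjoin w \<subseteq> CF.simple_extension \<rat> w"
    by (rule rat_adjoin_least) (rule CF.simple_extension_mem[OF subfieldE(1)[OF subfield_Rats]], simp)
  also have "\<dots> \<subseteq> rat_polys_at w"
  proof
    fix x assume "x \<in> CF.simple_extension \<rat> w"
    thus "x \<in> rat_polys_at w"
    proof (induction x rule: CF.simple_extension.induct)
      case zero
      show ?case using rat_mem_rat_polys_at[of 0 w] by simp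
    next
      case (lin k1 k2)
      thus ?case
        using power_mem_rat_polys_at[of w 1]
        by (auto elim!: Rats_cases intro!: rat_polys_at_add rat_polys_at_mult rat_mem_rat_polys_at)
    qed
  qed
  finally show "rat_adjoin w \<subseteq> rat_polys_at w" .
qed

text \<open>
  The irreducible polynomial of \<open>z\<close> over \<open>K\<close>, with its degree and its minimality, as an
  element of the type of complex polynomials.
\<close>
lemma field_degree_minimal_polynomial:
  assumes K: "subfield K complex_field" and n: "n > 0" and z: "z ^ n = 1"
  obtains f :: "complex poly"
  where "poly f z = 0" "\<And>i. Polynomial.coeff f i \<in> K"
    "Polynomial.degree f = field_degree (CF.simple_extension K z) K"
    "\<forall>q. (\<forall>i. Polynomial.coeff q i \<in> K) \<longrightarrow> poly q z = 0 \<longrightarrow> f dvd q"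
proof
  have sub: "subring K complex_field" using K by (rule subfieldE(1))
  have alg: "(CF.algebraic over K) z" by (rule root_of_unity_algebraic[OF K n z])
  note Irr = CF.IrrE[OF K _ alg, simplified]
  let ?I = "CF.Irr K z"
  let ?f = "Poly (rev ?I)"
  have "?I \<noteq> []"
    using Irr(2) unfolding ring_irreducible_def univ_poly_zero by auto
  hence I: "?I \<noteq> []" "hd ?I = 1" "set ?I \<subseteq> K"
    using Irr(1,3) by (auto simp: univ_poly_def polynomial_def)
  show "poly ?f z = 0" using Irr(4) by (simp add: eval_eq_poly)
  show "Polynomial.coeff ?f i \<in> K" for i
    using I(3) subfield_complex_closed(1)[OF K] nth_mem[of i "rev ?I"]
    by (auto simp: nth_default_def coeff_Poly_eq)
  have "coeffs ?f = rev ?I"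
    using I by (cases ?I) (simp_all add: coeffs_Poly)
  have deg: "Polynomial.degree ?f = length ?I - 1"
    using \<open>coeffs ?f = rev ?I\<close> I(1) by (simp add: degree_eq_length_coeffs)
  show "Polynomial.degree ?f = field_degree (CF.simple_extension K z) K"
    unfolding field_degree_def deg using CF.simple_extension_dim[OF K _ alg] by (simp add: over_def)
  show "\<forall>q. (\<forall>i. Polynomial.coeff q i \<in> K) \<longrightarrow> poly q z = 0 \<longrightarrow> ?f dvd q"
  proof (intro allI impI)
    fix q assume q_coeff: "\<forall>i. Polynomial.coeff q i \<in> K" and q_root: "poly q z = 0"
    let ?q = "rev (coeffs q)"
    have q: "?q \<in> carrier (univ_poly complex_field K)"
      by (rule rev_coeffs_mem_univ_poly) (use q_coeff in blast)
    have "CF.eval ?q z = 0" using q_root by (simp add: eval_eq_poly)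
    hence "?I divides\<^bsub>univ_poly complex_field K\<^esub> ?q"
      using CF.Irr_minimal[OF K _ alg q] CF.pdivides_iff_shell[OF K Irr(1) q] by simp
    then obtain h where h: "h \<in> carrier (univ_poly complex_field K)" "?q = ?I \<otimes>\<^bsub>univ_poly complex_field K\<^esub> h"
      by (auto simp: factor_def)
    have "poly q x = poly (?f * Poly (rev h)) x" for x
    proof -
      have "poly q x = CF.eval ?q x" by (simp add: eval_eq_poly)
      also have "\<dots> = CF.eval ?I x * CF.eval h x"
        using ring_hom_mult[OF CF.eval_is_hom[OF sub, of x] Irr(1) h(1)] h(2) by simp
      finally show ?thesis by (simp add: eval_eq_poly)
    qed
    hence "q = ?f * Poly (rev h)" by (simp add: poly_eq_poly_eq_iff[symmetric] fun_eq_iff)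
    thus "?f dvd q" by simp
  qed
qed

lemma rat_adjoin_eq_simple_extension:
  assumes "n > 0" "z ^ n = 1" "a \<in> rat_adjoin z"
  shows "rat_adjoin z = CF.simple_extension (rat_adjoin a) z"
proof
  note K = subfield_rat_adjoin[of a]
  have "subfield (CF.simple_extension (rat_adjoin a) z) complex_field"
    using CF.simple_extension_is_subfield[OF K, of z] root_of_unity_algebraic[OF K assms(1,2)] by simp
  thus "rat_adjoin z \<subseteq> CF.simple_extension (rat_adjoin a) z"
    by (rule rat_adjoin_least) (rule CF.simple_extension_mem[OF subfieldE(1)[OF K]], simp)
  show "CF.simple_extension (rat_adjoin a) z \<subseteq> rat_adjoin z"
    using rat_adjoin_subset_iff assms(3) rat_adjoin_self
    by (intro CF.simple_extension_subring_incl subfieldE(1)[OF subfield_rat_adjoin]) auto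
qed

section \<open>Roots of unity of prime power order\<close>
lemma root_of_unity_iff_cis_power:
  assumes "m > 0"
  shows "x ^ m = 1 \<longleftrightarrow> (\<exists>j<m. x = cis (2 * pi / real m) ^ j)"
proof -
  have "x ^ m = 1 \<longleftrightarrow> x \<in> (\<lambda>j. cis (2 * pi * real j / real m)) ` {..<m}"
    using bij_betw_imp_surj_on[OF bij_betw_roots_unity[OF assms]] by auto
  moreover have "cis (2 * pi * real j / real m) = cis (2 * pi / real m) ^ j" for j
    by (simp add: Complex.DeMoivre mult_ac)
  ultimately show ?thesis by auto
qed

lemma cis_power_eq_1 [simp]: "m > 0 \<Longrightarrow> cis (2 * pi / real m) ^ m = 1"
  by (simp add: Complex.DeMoivre)

lemma cis_power_dvd:
  assumes "m > 0" "f dvd m"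
  shows "cis (2 * pi / real f) = cis (2 * pi / real m) ^ (m div f)"
proof -
  have "real (m div f) * (2 * pi / real m) = 2 * pi / real f"
    using assms by (simp add: real_of_nat_div)
  thus ?thesis by (simp only: Complex.DeMoivre)
qed

text \<open>
  The first \<open>n\<close> powers of \<open>z\<close> are distinct, and there are only \<open>n\<close> roots of
  \<open>X ^ n - 1\<close>.
\<close>
lemma root_of_unity_eq_power:
  assumes z: "primitive_root_of_unity n z" and x: "x ^ n = 1"
  obtains j where "j < n" "x = z ^ j"
proof -
  have n: "n > 0" "z ^ n = 1" and ord: "\<And>j. 0 < j \<Longrightarrow> j < n \<Longrightarrow> z ^ j \<noteq> 1"
    using z by (auto simp: primitive_root_of_unity_def)
  have z0: "z \<noteq> 0" using n by (auto simp: zero_power)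
  have *: "i = j" if "i \<le> j" "j < n" "z ^ i = z ^ j" for i j
  proof -
    have "z ^ j = z ^ i * z ^ (j - i)" using that(1) by (simp flip: power_add)
    hence "z ^ i * z ^ (j - i) = z ^ i * 1" using that(3) by (simp only: mult_1_right)
    hence "z ^ (j - i) = 1" using z0 by (simp only: mult_cancel_left power_eq_0_iff) simp
    thus ?thesis using ord[of "j - i"] that by (cases "i = j") auto
  qed
  have "inj_on (\<lambda>j. z ^ j) {..<n}"
  proof (rule inj_onI)
    fix i j assume "i \<in> {..<n}" "j \<in> {..<n}" "z ^ i = z ^ j"
    thus "i = j" using *[of i j] *[of j i, symmetric] by (metis lessThan_iff nat_le_linear)
  qed
  hence "card ((\<lambda>j. z ^ j) ` {..<n}) = card {x :: complex. x ^ n = 1}"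
    using n by (simp add: card_image card_roots_unity_eq)
  moreover have "(\<lambda>j. z ^ j) ` {..<n} \<subseteq> {x :: complex. x ^ n = 1}"
  proof -
    have "(z ^ j) ^ n = (z ^ n) ^ j" for j by (simp add: power_mult[symmetric] mult.commute)
    thus ?thesis using n(2) by auto
  qed
  moreover have "finite {x :: complex. x ^ n = 1}"
    using n(1) by (intro finite_roots_unity) auto
  ultimately have "(\<lambda>j. z ^ j) ` {..<n} = {x :: complex. x ^ n = 1}"
    by (intro card_subset_eq) auto
  thus ?thesis using x that by auto
qed

lemma root_sums_eq:
  assumes z: "primitive_root_of_unity n z"
  shows "root_sums z = {s. \<forall>x\<in>#s. x ^ n = 1}"
proof (intro equalityI subsetI)
  have n: "n > 0" "z ^ n = 1" using z by (auto simp: primitive_root_of_unity_def)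
  fix s assume "s \<in> root_sums z"
  then obtain a where s: "s = root_sum z a" by (auto simp: root_sums_def)
  have "(z powi i) ^ n = 1" for i
  proof -
    have "(z powi i) ^ n = z powi (i * int n)"
      by (simp only: power_int_mult power_int_of_nat)
    also have "\<dots> = z powi (int n * i)" by (simp only: mult.commute)
    also have "\<dots> = 1" using n by (simp only: power_int_mult power_int_of_nat power_int_1_left)
    finally show ?thesis .
  qed
  thus "s \<in> {s. \<forall>x\<in>#s. x ^ n = 1}" by (auto simp: s root_sum_def)
next
  fix s :: "complex multiset" assume s: "s \<in> {s. \<forall>x\<in>#s. x ^ n = 1}"
  define e where "e = (\<lambda>x. SOME j. x = z ^ j)"
  have e: "z ^ e x = x" if "x \<in># s" for x
  proof -
    have "\<exists>j. x = z ^ j" using root_of_unity_eq_power[OF z, of x] s that by blast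
    from someI_ex[OF this] show ?thesis by (simp add: e_def)
  qed
  obtain xs where xs: "s = mset xs" by (metis ex_mset)
  have "map (\<lambda>i. z powi i) (map (\<lambda>x. int (e x)) xs) = map (\<lambda>x. x) xs"
    unfolding map_map by (rule map_cong) (use e xs in \<open>auto simp: o_def\<close>)
  hence "s = root_sum z (map (\<lambda>x. int (e x)) xs)"
    unfolding root_sum_def xs by (simp only: list.map_ident)
  thus "s \<in> root_sums z" by (simp add: root_sums_def)
qed

lemma sum_powers_root_of_unity:
  fixes u :: complex
  assumes "u ^ n = 1"
  shows "(\<Sum>i<n. u ^ i) = (if u = 1 then of_nat n else 0)"
  using assms by (auto simp: geometric_sum)

lemma power_gcd_eq_1:
  fixes x :: complex
  assumes "a > 0" "x ^ a = 1" "x ^ b = 1"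
  shows "x ^ gcd a b = 1"
proof -
  obtain i j where ij: "a * i = b * j + gcd a b"
    using bezout_nat[of a b] assms(1) by auto
  have "x ^ (a * i) = x ^ (b * j) * x ^ gcd a b" unfolding ij by (simp add: power_add)
  thus ?thesis using assms by (simp add: power_mult)
qed

lemma power_eq_1_dvd: "a dvd b \<Longrightarrow> (x :: complex) ^ a = 1 \<Longrightarrow> x ^ b = 1"
  by (metis dvdE power_mult power_one)

lemma sum_mset_diff_subset:
  "t \<subseteq># s \<Longrightarrow> sum_mset (s - t) = sum_mset s - (sum_mset t :: complex)"
  using sum_mset.union[of "s - t" t] by (simp add: subset_mset.diff_add)

lemma coprime_1_plus_mult:
  fixes N :: nat
  assumes "m dvd N"
  shows "coprime (1 + u * N) (m * N)"
proof -
  have "coprime (1 + u * N) N"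
    unfolding coprime_iff_gcd_eq_1 gcd.commute[of _ N] add.commute[of 1] gcd_add_mult by simp
  thus ?thesis using coprime_divisors[OF dvd_refl assms] by simp
qed

locale odd_prime_power =
  fixes p k :: nat
  assumes p: "Factorial_Ring.prime p" and odd_p: "odd p" and k: "k \<ge> 2"
begin

lemma p_gt_1: "p > 1" using p by (rule prime_gt_1_nat)

lemma power_p_k: "p ^ k = p * p ^ (k - 1)"
  using k by (cases k) auto

lemma gcd_prime_power:
  assumes "p ^ (k - 1) dvd N" "\<not> p ^ k dvd N"
  shows "gcd N (p ^ k) = p ^ (k - 1)"
proof -
  obtain i where i: "i \<le> k" "gcd N (p ^ k) = p ^ i"
    using divides_primepow_nat[OF p, of "gcd N (p ^ k)" k] by auto
  have "i \<noteq> k" using i(2) assms(2) gcd_dvd1[of N "p ^ k"] by auto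
  hence "p ^ i dvd p ^ (k - 1)" using i by (intro le_imp_power_dvd) auto
  moreover have "p ^ (k - 1) dvd gcd N (p ^ k)"
    using assms by (auto intro: le_imp_power_dvd)
  ultimately show ?thesis using i by (auto intro: dvd_antisym)
qed

lemma power_eq_1_iff_power_prime_power:
  fixes x :: complex
  assumes x: "x ^ p ^ k = 1" and N: "N > 0" "p ^ (k - 1) dvd N" "\<not> p ^ k dvd N"
  shows "x ^ N = 1 \<longleftrightarrow> x ^ p ^ (k - 1) = 1"
  using power_gcd_eq_1[OF N(1) _ x] gcd_prime_power[OF N(2,3)] power_eq_1_dvd[OF N(2)] by auto

text \<open>
  An order that divides \<open>p ^ k\<close> properly divides \<open>p ^ (k - 1)\<close>.
\<close>
lemma primitive_root_iff:
  assumes x: "x ^ p ^ k = 1"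
  shows "primitive_root_of_unity (p ^ k) x \<longleftrightarrow> x ^ p ^ (k - 1) \<noteq> 1"
proof
  assume "primitive_root_of_unity (p ^ k) x"
  moreover have "0 < p ^ (k - 1)" "p ^ (k - 1) < p ^ k"
    using p_gt_1 k by (auto intro: power_strict_increasing)
  ultimately show "x ^ p ^ (k - 1) \<noteq> 1"
    by (auto simp: primitive_root_of_unity_def)
next
  assume ne: "x ^ p ^ (k - 1) \<noteq> 1"
  have "x ^ j \<noteq> 1" if j: "0 < j" "j < p ^ k" for j
  proof
    assume "x ^ j = 1"
    hence g: "x ^ gcd j (p ^ k) = 1" using power_gcd_eq_1[of j x "p ^ k"] x j by auto
    obtain i where i: "i \<le> k" "gcd j (p ^ k) = p ^ i"
      using divides_primepow_nat[OF p, of "gcd j (p ^ k)" k] by auto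
    have "i \<noteq> k" using i(2) j dvd_imp_le[OF gcd_dvd1[of j "p ^ k"]] by auto
    hence "p ^ i dvd p ^ (k - 1)" using i by (intro le_imp_power_dvd) auto
    thus False using g i(2) ne power_eq_1_dvd[of "p ^ i" "p ^ (k - 1)" x] by simp
  qed
  thus "primitive_root_of_unity (p ^ k) x"
    using x p_gt_1 by (auto simp: primitive_root_of_unity_def)
qed

section \<open>Averaging out the entries of full order\<close>

text \<open>
  The factor \<open>x ^ (u * N)\<close> runs through the powers of \<open>x ^ N\<close>. If \<open>x\<close> has order
  \<open>p ^ k\<close>, then \<open>x ^ N\<close> is a primitive \<open>p\<close>-th root of unity and the sum over \<open>u\<close>
  vanishes; otherwise \<open>x ^ N = 1\<close>.
\<close>
lemma sum_mset_averages:
  assumes s: "\<And>x. x \<in># s \<Longrightarrow> x ^ p ^ k = 1"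
    and N: "N > 0" "p ^ (k - 1) dvd N" "\<not> p ^ k dvd N"
  shows "(\<Sum>u<p. \<Sum>x\<in>#s. x ^ (1 + u * N)) = of_nat p * (sum_mset s - sum_mset (order_part s (p ^ k)))"
  using s
proof (induction s)
  case empty
  show ?case by (simp add: order_part_def)
next
  case (add x s)
  have x: "x ^ p ^ k = 1" using add.prems by simp
  have "p ^ k dvd N * p" using N(2) unfolding power_p_k by (simp add: mult.commute)
  hence "(x ^ N) ^ p = 1" using x power_eq_1_dvd by (simp add: power_mult[symmetric])
  hence "(\<Sum>u<p. x ^ (1 + u * N)) = x * (if x ^ N = 1 then of_nat p else 0)"
    using sum_powers_root_of_unity[of "x ^ N" p]
    by (simp add: sum_distrib_left[symmetric] power_mult mult.commute[of _ N] del: if_split)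
  also have "x ^ N = 1 \<longleftrightarrow> \<not> primitive_root_of_unity (p ^ k) x"
    using power_eq_1_iff_power_prime_power[OF x N] primitive_root_iff[OF x] by simp
  finally show ?case
    using add by (simp add: sum.distrib order_part_def algebra_simps)
qed

text \<open>
  The inner sums of \<open>sum_mset_averages\<close> are conjugates of the value. The conjugation takes place
  in the field of \<open>(p * N)\<close>-th roots of unity, which contains both the entries of \<open>s\<close> and the
  \<open>N\<close>-th cyclotomic field; \<open>1 + u * N\<close> is coprime to \<open>p * N\<close> because \<open>p\<close> divides
  \<open>N\<close>, where \<open>k \<ge> 2\<close> enters.
\<close>
lemma galois_conj_order_part:
  assumes s: "\<And>x. x \<in># s \<Longrightarrow> x ^ p ^ k = 1"
    and N: "N > 0" "p ^ (k - 1) dvd N" "\<not> p ^ k dvd N"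
  shows "(\<Sum>u<p. galois_conj (cis (2 * pi / real (p * N))) (1 + u * N) (sum_mset s)) =
    of_nat p * (sum_mset s - sum_mset (order_part s (p ^ k)))"
proof -
  let ?w = "cis (2 * pi / real (p * N))"
  have pN: "p * N > 0" using p_gt_1 N by simp
  have "p dvd p ^ (k - 1)" using k by (simp add: dvd_power)
  hence pdvd: "p dvd N" using N(2) dvd_trans by blast
  have cop: "coprime (1 + u * N) (p * N)" for u
    using coprime_1_plus_mult[OF pdvd] .
  have w: "?w ^ (p * N) = 1" using pN by (rule cis_power_eq_1)
  have ex: "\<exists>j. x = ?w ^ j" if "x \<in># s" for x
  proof -
    have "p ^ k dvd p * N" using N(2) unfolding power_p_k by simp
    hence "x ^ (p * N) = 1" using s[OF that] power_eq_1_dvd by blast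
    thus ?thesis using root_of_unity_iff_cis_power[OF pN, of x] by auto
  qed
  have "galois_conj ?w (1 + u * N) (sum_mset s) = (\<Sum>x\<in>#s. x ^ (1 + u * N))" for u
    by (rule galois_conj_sum_mset[OF pN w cop ex])
  thus ?thesis using sum_mset_averages[OF s N] by simp
qed

text \<open>
  The exponent \<open>1 + u * N\<close> fixes all \<open>N\<close>-th roots of unity, hence a value in their field is
  equal to its own average.
\<close>
lemma order_part_eq_0_if_mem_cyclotomic_field:
  assumes s: "\<And>x. x \<in># s \<Longrightarrow> x ^ p ^ k = 1"
    and N: "N > 0" "p ^ (k - 1) dvd N" "\<not> p ^ k dvd N"
    and mem: "sum_mset s \<in> cyclotomic_field N"
  shows "sum_mset (order_part s (p ^ k)) = 0"
proof -
  let ?w = "cis (2 * pi / real (p * N))"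
  have pN: "p * N > 0" using p_gt_1 N by simp
  have w: "?w ^ (p * N) = 1" using pN by (rule cis_power_eq_1)
  have wp: "cis (2 * pi / real N) = ?w ^ p"
    using cis_power_dvd[OF pN, of N] N(1) by simp
  have "sum_mset s \<in> rat_polys_at (?w ^ p)"
    using mem rat_adjoin_root_of_unity[OF N(1) cis_power_eq_1[OF N(1)]]
    unfolding cyclotomic_field_def wp by simp
  then obtain f where f: "sum_mset s = rat_poly_value f (?w ^ p)"
    by (auto simp: rat_polys_at_def)
  have "p dvd p ^ (k - 1)" using k by (simp add: dvd_power)
  hence pdvd: "p dvd N" using N(2) dvd_trans by blast
  have "galois_conj ?w (1 + u * N) (sum_mset s) = sum_mset s" for u
  proof -
    note cop = coprime_1_plus_mult[OF pdvd, of u]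
    have "(?w ^ (1 + u * N)) ^ p = ?w ^ p * (?w ^ (p * N)) ^ u"
      by (simp add: algebra_simps flip: power_mult power_add)
    thus ?thesis
      using galois_conj_value[OF pN w cop, of "pcompose f (monom 1 p)"] w by (simp add: f)
  qed
  hence "of_nat p * sum_mset s = of_nat p * (sum_mset s - sum_mset (order_part s (p ^ k)))"
    using galois_conj_order_part[of s N, OF s N] by (simp only: sum_constant card_lessThan)
  thus ?thesis using p_gt_1 by simp
qed

end

section \<open>Vanishing sums and minimal representatives\<close>

text \<open>
  Fourier inversion: the multiplicities of \<open>s\<close> are recovered from its power sums.
\<close>
lemma sum_mset_powers_inverse:
  fixes y :: complex
  assumes n: "n > 0" and s: "\<And>x. x \<in># s \<Longrightarrow> x ^ n = 1" and y: "y ^ n = 1"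
  shows "(\<Sum>i<n. (\<Sum>x\<in>#s. x ^ i) * inverse y ^ i) = of_nat n * of_nat (count s y)"
  using s
proof (induction s)
  case empty
  show ?case by simp
next
  case (add x s)
  have y0: "y \<noteq> 0" using y n by (auto simp: zero_power)
  have "(x * inverse y) ^ n = 1" using add.prems y by (simp add: power_mult_distrib power_inverse)
  hence "(\<Sum>i<n. x ^ i * inverse y ^ i) = (if x = y then of_nat n else 0)"
    using sum_powers_root_of_unity[of "x * inverse y" n] y0
    by (simp add: power_mult_distrib field_simps)
  thus ?case using add by (simp add: algebra_simps sum.distrib)
qed

context odd_prime_power
begin

text \<open>For \<open>i\<close> prime to \<open>p\<close> the \<open>i\<close>-th power sum is a conjugate of the value.\<close>
lemma power_sums_eq:
  fixes s t :: "complex multiset"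
  assumes s: "\<And>x. x \<in># s \<Longrightarrow> x ^ p ^ k = 1" and t: "\<And>x. x \<in># t \<Longrightarrow> x ^ p ^ k = 1"
    and eq: "sum_mset s = sum_mset t" and i: "\<not> p dvd i"
  shows "(\<Sum>x\<in>#s. x ^ i) = (\<Sum>x\<in>#t. x ^ i)"
proof -
  let ?w = "cis (2 * pi / real (p ^ k))"
  have n: "p ^ k > 0" using p_gt_1 by simp
  have cop: "coprime i (p ^ k)"
    using i p prime_imp_coprime[of p i] by (simp add: coprime_commute)
  have "\<exists>j. x = ?w ^ j" if "x ^ p ^ k = 1" for x
    using that root_of_unity_iff_cis_power[OF n, of x] by blast
  hence conj: "galois_conj ?w i (sum_mset r) = (\<Sum>x\<in>#r. x ^ i)" if "\<And>x. x \<in># r \<Longrightarrow> x ^ p ^ k = 1" for r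
    using galois_conj_sum_mset[OF n cis_power_eq_1[OF n] cop, of r] that by blast
  show ?thesis using conj[of s, OF s] conj[of t, OF t] eq by simp

qed

text \<open>
  In the Fourier expansion of the difference of the multiplicities at \<open>y\<close>, the coefficients at
  exponents \<open>i\<close> prime to \<open>p\<close> vanish by \<open>power_sums_eq\<close>; for the other ones
  \<open>r ^ i = 1\<close>. So every term takes the same value at \<open>r * y\<close> as at \<open>y\<close>.
\<close>
lemma count_diff_invariant:
  fixes s t :: "complex multiset"
  assumes s: "\<And>x. x \<in># s \<Longrightarrow> x ^ p ^ k = 1" and t: "\<And>x. x \<in># t \<Longrightarrow> x ^ p ^ k = 1"
    and eq: "sum_mset s = sum_mset t" and y: "y ^ p ^ k = 1" and r: "r ^ p = 1"
  shows "int (count s (r * y)) - int (count t (r * y)) = int (count s y) - int (count t y)"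
proof -
  have n: "p ^ k > 0" using p_gt_1 by simp
  define D where "D = (\<lambda>i. (\<Sum>x\<in>#s. x ^ i) - (\<Sum>x\<in>#t. x ^ i))"
  have D: "(\<Sum>i<p ^ k. D i * inverse x ^ i) = of_nat (p ^ k) * of_int (int (count s x) - int (count t x))"
    if "x ^ p ^ k = 1" for x
    using sum_mset_powers_inverse[OF n s that] sum_mset_powers_inverse[OF n t that]
    by (simp add: D_def left_diff_distrib right_diff_distrib sum_subtractf)
  have "r ^ p ^ k = 1" using r unfolding power_p_k by (simp add: power_mult)
  hence ry: "(r * y) ^ p ^ k = 1" using y by (simp add: power_mult_distrib)
  have "D i * inverse (r * y) ^ i = D i * inverse y ^ i" for i
  proof (cases "p dvd i")
    case True
    hence "r ^ i = 1" using r power_eq_1_dvd by blast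
    thus ?thesis by (simp add: power_mult_distrib power_inverse)
  next
    case False
    have "D i = 0" unfolding D_def using power_sums_eq[of s t, OF s t eq False] by simp
    thus ?thesis by simp
  qed
  hence "(\<Sum>i<p ^ k. D i * inverse (r * y) ^ i) = (\<Sum>i<p ^ k. D i * inverse y ^ i)"
    by (simp only:)
  hence "of_nat (p ^ k) * of_int (int (count s (r * y)) - int (count t (r * y))) =
      (of_nat (p ^ k) * of_int (int (count s y) - int (count t y)) :: complex)"
    using D[OF ry] D[OF y] by (simp only:)
  moreover have "(of_nat (p ^ k) :: complex) \<noteq> 0" using p_gt_1 by simp
  ultimately show ?thesis by (simp only: mult_cancel_left of_int_eq_iff) simp
qed

text \<open>
  Such a set \<open>A\<close> is a disjoint union of cosets of the \<open>p\<close>-th roots of unity, which are the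
  fibres of the \<open>p\<close>-th power map; each has \<open>p\<close> elements with the same value of \<open>c\<close>.
\<close>
lemma prime_dvd_sum_of_invariant:
  fixes A :: "complex set" and c :: "complex \<Rightarrow> nat"
  assumes A: "finite A" "0 \<notin> A" and inv: "\<And>x r. x \<in> A \<Longrightarrow> r ^ p = 1 \<Longrightarrow> r * x \<in> A \<and> c (r * x) = c x"
  shows "p dvd (\<Sum>x\<in>A. c x)"
proof -
  let ?R = "{r :: complex. r ^ p = 1}"
  have "p dvd (\<Sum>x\<in>{x\<in>A. x ^ p = y}. c x)" if y: "y \<in> (\<lambda>x. x ^ p) ` A" for y
  proof -
    obtain a where a: "a \<in> A" "y = a ^ p" using y by auto
    have a0: "a \<noteq> 0" using a A by auto
    have "x \<in> (\<lambda>r. r * a) ` ?R" if "x \<in> A" "x ^ p = a ^ p" for x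
      using that a0 by (intro image_eqI[of _ _ "x / a"]) (auto simp: power_divide)
    hence img: "{x\<in>A. x ^ p = y} = (\<lambda>r. r * a) ` ?R"
      using a inv[OF a(1)] by (auto simp: power_mult_distrib)
    have inj: "inj_on (\<lambda>r. r * a) ?R" using a0 by (auto simp: inj_on_def)
    have "(\<Sum>x\<in>{x\<in>A. x ^ p = y}. c x) = (\<Sum>r\<in>?R. c (r * a))"
      unfolding img by (simp add: sum.reindex[OF inj])
    also have "\<dots> = (\<Sum>r\<in>?R. c a)"
      by (rule sum.cong) (use inv[OF a(1)] in auto)
    also have "\<dots> = p * c a" using p_gt_1 by (simp add: card_roots_unity_eq)
    finally show ?thesis by simp
  qed
  moreover have "(\<Sum>x\<in>A. c x) = (\<Sum>y\<in>(\<lambda>x. x ^ p) ` A. \<Sum>x\<in>{x\<in>A. x ^ p = y}. c x)"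
    by (rule sum.image_gen[OF A(1)])
  ultimately show ?thesis by (simp add: dvd_sum)
qed

text \<open>
  Compare the full-order part with the empty sum, which has the same value.
\<close>
lemma prime_dvd_order_counts:
  assumes s: "\<And>x. x \<in># s \<Longrightarrow> x ^ p ^ k = 1" and z: "sum_mset (order_part s (p ^ k)) = 0"
  shows "p dvd order_count s (p ^ k)" "p dvd distinct_order_count s (p ^ k)"
proof -
  let ?t = "order_part s (p ^ k)"
  have t: "x ^ p ^ k = 1" if "x \<in># ?t" for x using that s by (auto simp: order_part_def)
  have inv: "count ?t (r * x) = count ?t x" if "x \<in> set_mset ?t" "r ^ p = 1" for x r
    using count_diff_invariant[of ?t "{#}" x r] t that z by auto
  have "r * x \<in> set_mset ?t" if "x \<in> set_mset ?t" "r ^ p = 1" for x r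
    using inv[OF that] that(1) by (metis count_eq_zero_iff)
  moreover have "0 \<notin> set_mset ?t" using t[of 0] p_gt_1 by (auto simp: zero_power)
  ultimately show "p dvd order_count s (p ^ k)" "p dvd distinct_order_count s (p ^ k)"
    using prime_dvd_sum_of_invariant[of "set_mset ?t" "count ?t"] inv
      prime_dvd_sum_of_invariant[of "set_mset ?t" "\<lambda>_. 1"]
    by (auto simp: order_count_def distinct_order_count_def size_multiset_overloaded_eq)
qed

text \<open>
  By \<open>galois_conj_order_part\<close> the value alone determines the average of its conjugates, hence
  the value of the full-order part.
\<close>
lemma order_parts_eq:
  fixes s t :: "complex multiset"
  assumes s: "\<And>x. x \<in># s \<Longrightarrow> x ^ p ^ k = 1" and t: "\<And>x. x \<in># t \<Longrightarrow> x ^ p ^ k = 1"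
    and eq: "sum_mset s = sum_mset t"
  shows "sum_mset (order_part s (p ^ k)) = sum_mset (order_part t (p ^ k))"
proof -
  have N: "p ^ (k - 1) > 0" "p ^ (k - 1) dvd p ^ (k - 1)" "\<not> p ^ k dvd p ^ (k - 1)"
    using p_gt_1 k power_dvd_imp_le[of p k "k - 1"] by auto
  have "of_nat p * (sum_mset s - sum_mset (order_part s (p ^ k))) =
      of_nat p * (sum_mset t - sum_mset (order_part t (p ^ k)))"
    using galois_conj_order_part[of s, OF s N] galois_conj_order_part[of t, OF t N] eq by (simp only:)
  thus ?thesis using p_gt_1 eq by simp
qed

text \<open>
  If \<open>y\<close> occurred more often in \<open>s\<close> than in \<open>t\<close>, so would every \<open>r * y\<close> with
  \<open>r ^ p = 1\<close>. Then \<open>s\<close> would contain the whole coset of \<open>y\<close>, whose sum is zero.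
\<close>
lemma subset_mset_of_vanishing_free:
  fixes s t :: "complex multiset"
  assumes s: "\<And>x. x \<in># s \<Longrightarrow> x ^ p ^ k = 1" and t: "\<And>x. x \<in># t \<Longrightarrow> x ^ p ^ k = 1"
    and eq: "sum_mset s = sum_mset t"
    and free: "\<And>u. u \<subseteq># s \<Longrightarrow> u \<noteq> {#} \<Longrightarrow> sum_mset u \<noteq> 0"
  shows "s \<subseteq># t"
proof (rule mset_subset_eqI, rule ccontr)
  fix y assume "\<not> count s y \<le> count t y"
  hence less: "count t y < count s y" by simp
  hence "y \<in># s" by (metis count_eq_zero_iff not_less_zero)
  hence y: "y ^ p ^ k = 1" by (rule s)
  have y0: "y \<noteq> 0" using y p_gt_1 by (auto simp: zero_power)
  let ?R = "{r :: complex. r ^ p = 1}"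
  let ?u = "mset_set ((\<lambda>r. r * y) ` ?R)"
  have fin: "finite ?R" using p_gt_1 by (intro finite_roots_unity) auto
  have "count s (r * y) \<ge> 1" if "r ^ p = 1" for r
    using count_diff_invariant[of s t, OF s t eq y that] less by linarith
  hence "?u \<subseteq># s"
    using fin by (auto intro!: mset_subset_eqI simp: count_mset_set')
  moreover have "?u \<noteq> {#}"
    using fin by (auto simp: mset_set_empty_iff intro!: exI[of _ 1])
  moreover have "sum_mset ?u = 0"
  proof -
    have "sum_mset ?u = (\<Sum>x\<in>(\<lambda>r. r * y) ` ?R. x)"
      by (simp add: sum_unfold_sum_mset)
    also have "\<dots> = (\<Sum>r\<in>?R. r * y)"
      by (rule sum.reindex_cong[of "\<lambda>r. r * y"]) (use y0 in \<open>auto simp: inj_on_def\<close>)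
    also have "\<dots> = (\<Sum>r\<in>?R. r) * y" by (simp add: sum_distrib_right)
    also have "\<dots> = 0" using sum_roots_unity[of p] p_gt_1 by simp
    finally show ?thesis .
  qed
  ultimately show False using free by blast
qed

text \<open>
  A minimal representative is a member of the class without any non-empty vanishing subsum. A
  member of least size has this property, because removing a vanishing subsum does not leave the
  class; uniqueness is \<open>subset_mset_of_vanishing_free\<close> in both directions.
\<close>
lemma ex1_minimal_representative:
  assumes z: "primitive_root_of_unity (p ^ k) z" and C: "C \<in> root_sums z // same_value z"
  shows "\<exists>!t. minimal_representative C t"
proof -
  note rs = root_sums_eq[OF z]
  obtain s0 where s0: "s0 \<in> root_sums z" "C = same_value z `` {s0}"
    using C by (auto simp: quotient_def)
  hence memC: "t \<in> C \<longleftrightarrow> (\<forall>x\<in>#t. x ^ p ^ k = 1) \<and> sum_mset t = sum_mset s0" for t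
    by (auto simp: same_value_def rs)
  have min_iff: "minimal_representative C t \<longleftrightarrow>
      t \<in> C \<and> (\<forall>u. u \<subseteq># t \<longrightarrow> u \<noteq> {#} \<longrightarrow> sum_mset u \<noteq> 0)" for t
    unfolding minimal_representative_def minimal_sum_def subset_mset.le_less by auto
  obtain t where t: "t \<in> C" and small: "\<And>u. u \<in> C \<Longrightarrow> size t \<le> size u"
    using arg_min_nat_lemma[of "\<lambda>t. t \<in> C" s0 size] s0(1) memC[of s0] rs by auto
  have "minimal_representative C t"
    unfolding min_iff
  proof (intro conjI allI impI t)
    fix u assume u: "u \<subseteq># t" "u \<noteq> {#}"
    show "sum_mset u \<noteq> 0"
    proof
      assume "sum_mset u = 0"
      hence "sum_mset (t - u) = sum_mset t" using sum_mset_diff_subset[OF u(1)] by simp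
      hence "t - u \<in> C" using t by (auto simp: memC dest: in_diffD)
      from small[OF this] have "size t \<le> size t - size u" by (simp add: size_Diff_submset[OF u(1)])
      moreover have "size u > 0" "size u \<le> size t"
        using u by (auto simp: size_mset_mono nonempty_has_size[symmetric])
      ultimately show False by simp
    qed
  qed
  moreover have "t1 = t2" if "minimal_representative C t1" "minimal_representative C t2" for t1 t2
  proof -
    have *: "t1 \<subseteq># t2" if "minimal_representative C t1" "minimal_representative C t2" for t1 t2
      using that subset_mset_of_vanishing_free[of t1 t2] unfolding min_iff memC by auto
    show ?thesis using *[of t1 t2] *[of t2 t1] that by auto
  qed
  ultimately show ?thesis by blast
qed

section \<open>The conductor\<close>

text \<open>The entries that remain after dropping the full-order part are \<open>p ^ (k - 1)\<close>-th roots of unity.\<close>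
lemma sum_mset_mem_cyclotomic_field_if_order_part_0:
  assumes s: "\<And>x. x \<in># s \<Longrightarrow> x ^ p ^ k = 1" and z: "sum_mset (order_part s (p ^ k)) = 0"
  shows "sum_mset s \<in> cyclotomic_field (p ^ (k - 1))"
proof -
  have n: "p ^ (k - 1) > 0" using p_gt_1 by simp
  let ?t = "filter_mset (\<lambda>x. \<not> primitive_root_of_unity (p ^ k) x) s"
  have "s = order_part s (p ^ k) + ?t" by (simp add: order_part_def)
  hence "sum_mset s = sum_mset (order_part s (p ^ k)) + sum_mset ?t"
    by (metis sum_mset.union)
  also have "\<dots> = sum_mset ?t" using z by simp
  also have "\<dots> \<in> cyclotomic_field (p ^ (k - 1))"
    unfolding cyclotomic_field_def
  proof (rule subfield_complex_sum_mset[OF subfield_rat_adjoin])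
    fix x assume "x \<in># ?t"
    hence "x ^ p ^ (k - 1) = 1" using primitive_root_iff s by auto
    then obtain j where "x = cis (2 * pi / real (p ^ (k - 1))) ^ j"
      using root_of_unity_iff_cis_power[OF n, of x] by blast
    thus "x \<in> rat_adjoin (cis (2 * pi / real (p ^ (k - 1))))"
      using subfield_complex_power[OF subfield_rat_adjoin rat_adjoin_self] by simp
  qed
  finally show ?thesis .
qed

lemma sum_mset_mem_cyclotomic_field:
  assumes s: "\<And>x. x \<in># s \<Longrightarrow> x ^ n = 1" and n: "n > 0"
  shows "sum_mset s \<in> cyclotomic_field n"
  unfolding cyclotomic_field_def
proof (rule subfield_complex_sum_mset[OF subfield_rat_adjoin])
  fix x assume "x \<in># s"
  then obtain j where "x = cis (2 * pi / real n) ^ j"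
    using root_of_unity_iff_cis_power[OF n, of x] s by blast
  thus "x \<in> rat_adjoin (cis (2 * pi / real n))"
    using subfield_complex_power[OF subfield_rat_adjoin rat_adjoin_self] by simp
qed

lemma cyclotomic_field_mono:
  assumes "f dvd m" "m > 0"
  shows "cyclotomic_field f \<subseteq> cyclotomic_field m"
  unfolding cyclotomic_field_def rat_adjoin_subset_iff cis_power_dvd[OF assms(2,1)]
  by (rule subfield_complex_power[OF subfield_rat_adjoin rat_adjoin_self])

text \<open>
  For the harder direction let \<open>f < p ^ k\<close> and write \<open>f = p ^ j * m\<close> with \<open>m\<close> prime to
  \<open>p\<close>. Then \<open>j < k\<close>, so the \<open>f\<close>-th cyclotomic field is contained in the \<open>N\<close>-th one for
  \<open>N = p ^ (k - 1) * m\<close>, to which the averaging argument applies.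
\<close>
lemma conductor_eq_iff:
  assumes s: "\<And>x. x \<in># s \<Longrightarrow> x ^ p ^ k = 1"
  shows "conductor s = p ^ k \<longleftrightarrow> sum_mset (order_part s (p ^ k)) \<noteq> 0"
proof -
  let ?P = "\<lambda>f. f > 0 \<and> sum_mset s \<in> cyclotomic_field f"
  have cond: "conductor s = (LEAST f. ?P f)"
    by (simp add: conductor_def sum_field_def cyclotomic_field_def rat_adjoin_subset_iff)
  have n: "p ^ k > 0" using p_gt_1 by simp
  have top: "?P (p ^ k)" using sum_mset_mem_cyclotomic_field[OF s n] n by simp
  show ?thesis
  proof (cases "sum_mset (order_part s (p ^ k)) = 0")
    case True
    have "?P (p ^ (k - 1))"
      using sum_mset_mem_cyclotomic_field_if_order_part_0[OF s True] p_gt_1 by simp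
    hence "conductor s \<le> p ^ (k - 1)" unfolding cond by (rule Least_le)
    also have "\<dots> < p ^ k" using p_gt_1 k by (intro power_strict_increasing) auto
    finally show ?thesis using True by simp
  next
    case False
    have "p ^ k \<le> f" if f: "?P f" for f
    proof (rule ccontr)
      assume lt: "\<not> p ^ k \<le> f"
      obtain m j where m: "f = p ^ j * m" "\<not> p dvd m"
        using multiplicity_decompose'[of f p] f p_gt_1 by (metis less_irrefl nat_dvd_1_iff_1)

      have m0: "m > 0" using m f by (cases m) auto
      have "j < k"
      proof (rule ccontr)
        assume "\<not> j < k"
        hence "p ^ k \<le> p ^ j" using p_gt_1 by (intro power_increasing) auto
        also have "\<dots> \<le> f" using m(1) m0 by simp
        finally show False using lt by simp
      qed
      \<comment> \<open>the least multiple of \<open>p ^ (k - 1)\<close> and \<open>f\<close>\<close>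
      let ?N = "p ^ (k - 1) * m"
      have N: "?N > 0" "p ^ (k - 1) dvd ?N" using p_gt_1 m0 by auto
      have "\<not> p ^ k dvd ?N" using m(2) p_gt_1 unfolding power_p_k by (simp add: mult.commute)
      moreover have "f dvd ?N" unfolding m(1) using \<open>j < k\<close> by (intro mult_dvd_mono le_imp_power_dvd) auto
      hence "sum_mset s \<in> cyclotomic_field ?N" using f cyclotomic_field_mono[OF _ N(1)] by blast
      ultimately show False
        using order_part_eq_0_if_mem_cyclotomic_field[OF s N] False by blast
    qed
    hence "conductor s = p ^ k" unfolding cond using top by (intro Least_equality)
    thus ?thesis using False by simp
  qed
qed

end

section \<open>Powers congruent to one modulo prime powers\<close>
lemma dvd_sum_upto_odd:
  assumes "odd (p :: nat)"
  shows "int p dvd (\<Sum>i<p. int i)"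
proof -
  have "2 * (\<Sum>i<p. int i) = int p * (int p - 1)"
    by (induction p) (auto simp: algebra_simps)
  hence "int p dvd 2 * (\<Sum>i<p. int i)" by simp
  moreover have "coprime (int p) 2" using assms by simp
  ultimately show ?thesis by (simp add: coprime_dvd_mult_right_iff)
qed

text \<open>
  Modulo \<open>p\<^sup>2\<close> the powers of \<open>r = 1 + p v\<close> are \<open>1 + i p v\<close>, so the sum is
  \<open>p + p v (0 + 1 + \<dots> + (p - 1))\<close>, and the bracket is divisible by \<open>p\<close> as \<open>p\<close> is odd.
\<close>
lemma geometric_sum_cong_odd:
  assumes p: "odd (p :: nat)" and r: "int p dvd r - 1"
  obtains c where "(\<Sum>i<p. r ^ i) = int p * (1 + int p * c)"
proof -
  obtain v where v: "r = 1 + int p * v" using r by (metis add_diff_cancel_left' diff_add_cancel dvdE add.commute)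
  have "\<exists>d. r ^ i = 1 + int i * int p * v + (int p)\<^sup>2 * d" for i
  proof (induction i)
    case 0
    show ?case by (rule exI[of _ 0]) simp
  next
    case (Suc i)
    then obtain d where d: "r ^ i = 1 + int i * int p * v + (int p)\<^sup>2 * d" by blast
    have "r ^ Suc i = (1 + int p * v) * (1 + int i * int p * v + (int p)\<^sup>2 * d)"
      by (simp add: d flip: v)
    also have "\<dots> = 1 + int (Suc i) * int p * v + (int p)\<^sup>2 * (d + int i * v * v + int p * v * d)"
      by (simp add: algebra_simps power2_eq_square)
    finally show ?case by blast
  qed
  then obtain d where d: "\<And>i. r ^ i = 1 + int i * int p * v + (int p)\<^sup>2 * d i" by metis
  obtain e where e: "(\<Sum>i<p. int i) = int p * e" using dvd_sum_upto_odd[OF p] by (elim dvdE)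
  have "(\<Sum>i<p. r ^ i) = int p + (\<Sum>i<p. int i) * (int p * v) + (int p)\<^sup>2 * (\<Sum>i<p. d i)"
    unfolding d by (simp add: sum.distrib sum_distrib_left sum_distrib_right mult.assoc)
  also have "\<dots> = int p * (1 + int p * (e * v + (\<Sum>i<p. d i)))"
    unfolding e by (simp add: algebra_simps power2_eq_square)
  finally show ?thesis by (rule that)
qed

context odd_prime_power
begin

text \<open>
  The second factor of \<open>r ^ p - 1 = (r - 1) (1 + r + \<dots> + r ^ (p - 1))\<close> contains exactly one
  factor \<open>p\<close>.
\<close>
lemma lifting_the_exponent:
  fixes r :: int
  assumes j: "j \<ge> 1" and r: "int p ^ j dvd r - 1" "\<not> int p ^ Suc j dvd r - 1"
  shows "int p ^ Suc j dvd r ^ p - 1" "\<not> int p ^ Suc (Suc j) dvd r ^ p - 1"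
proof -
  have "int p dvd int p ^ j" using j by (simp add: dvd_power)
  hence "int p dvd r - 1" using r(1) dvd_trans by blast
  then obtain c where c: "(\<Sum>i<p. r ^ i) = int p * (1 + int p * c)"
    using geometric_sum_cong_odd[OF odd_p] by blast
  obtain a where a: "r - 1 = int p ^ j * a" using r(1) by (elim dvdE)
  have eq: "r ^ p - 1 = int p ^ Suc j * (a * (1 + int p * c))"
    unfolding power_diff_1_eq c a by simp
  show "int p ^ Suc j dvd r ^ p - 1" unfolding eq by simp
  have pr: "Factorial_Ring.prime (int p)" using p by simp
  have "\<not> int p dvd a" using r(2) p_gt_1 unfolding a by (auto simp: mult.commute[of "int p"])
  moreover have "\<not> int p dvd 1 + int p * c"
  proof
    assume "int p dvd 1 + int p * c"
    hence "int p dvd 1" using dvd_add_left_iff[of "int p" "int p * c" 1] by simp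
    thus False using p_gt_1 by simp
  qed
  ultimately have "\<not> int p dvd a * (1 + int p * c)"
    using prime_dvd_mult_iff[OF pr] by blast
  thus "\<not> int p ^ Suc (Suc j) dvd r ^ p - 1"
    unfolding eq power_Suc2[of _ "Suc j"] using p_gt_1 by (simp del: power_Suc)
qed

text \<open>Raise to the power \<open>p\<close> until the exact exponent has grown to \<open>k - 1\<close>.\<close>
lemma power_cong_1_exactly:
  fixes r :: int
  assumes "j \<ge> 1" "j \<le> k - 1" "int p ^ j dvd r - 1" "\<not> int p ^ k dvd r - 1"
  shows "\<exists>e. int p ^ (k - 1) dvd r ^ e - 1 \<and> \<not> int p ^ k dvd r ^ e - 1"
  using assms
proof (induction "k - 1 - j" arbitrary: j r)
  case 0
  hence "j = k - 1" by simp
  thus ?case using 0 by (intro exI[of _ 1]) simp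
next
  case (Suc m)
  have j: "Suc j \<le> k - 1" using Suc.hyps(2) by simp
  show ?case
  proof (cases "int p ^ Suc j dvd r - 1")
    case True
    thus ?thesis using Suc.hyps(1)[of "Suc j" r] Suc.hyps(2) Suc.prems j by simp
  next
    case False
    note lte = lifting_the_exponent[OF Suc.prems(1,3) False]
    have "int p ^ Suc (Suc j) dvd int p ^ k" using j k by (intro le_imp_power_dvd) simp
    hence "\<not> int p ^ k dvd r ^ p - 1" using lte(2) dvd_trans by blast
    moreover have "m = k - 1 - Suc j" using Suc.hyps(2) by simp
    ultimately obtain e where "int p ^ (k - 1) dvd (r ^ p) ^ e - 1 \<and> \<not> int p ^ k dvd (r ^ p) ^ e - 1"
      using Suc.hyps(1)[OF _ _ j lte(1)] by auto
    thus ?thesis by (intro exI[of _ "p * e"]) (simp add: power_mult)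
  qed
qed

end

lemma power_cong_exponent:
  fixes x :: complex
  assumes "x ^ n = 1" "[a = b] (mod n)"
  shows "x ^ a = x ^ b"
proof -
  have "x ^ c = x ^ (c mod n)" for c
  proof -
    have "x ^ c = x ^ (n * (c div n) + c mod n)" by simp
    also have "\<dots> = x ^ (c mod n)" using assms(1) by (simp only: power_add power_mult power_one mult_1)
    finally show ?thesis .
  qed
  from this[of a] this[of b] show ?thesis using assms(2) by (simp add: cong_def)
qed

context odd_prime_power
begin

section \<open>Exponents whose conjugation fixes the value\<close>

text \<open>
  Modulo \<open>p ^ k\<close> these exponents are the Galois group of the \<open>p ^ k\<close>-th cyclotomic field over
  the field generated by the value of \<open>s\<close>.
\<close>
definition fixes_sum :: "complex multiset \<Rightarrow> nat \<Rightarrow> bool" where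
  "fixes_sum s t \<longleftrightarrow> \<not> p dvd t \<and> (\<Sum>x\<in>#s. x ^ t) = sum_mset s"

context
  fixes s :: "complex multiset"
  assumes s: "\<And>x. x \<in># s \<Longrightarrow> x ^ p ^ k = 1"
begin

lemma fixes_sum_1: "fixes_sum s 1"
  using p_gt_1 by (simp add: fixes_sum_def)

lemma fixes_sum_cong:
  assumes "fixes_sum s t" "[t = t'] (mod p ^ k)"
  shows "fixes_sum s t'"
proof -
  have "[t = t'] (mod p)"
    by (rule cong_dvd_modulus_nat[OF assms(2)]) (use k in \<open>simp add: dvd_power\<close>)
  hence "p dvd t \<longleftrightarrow> p dvd t'" by (rule cong_dvd_iff)
  moreover have "(\<Sum>x\<in>#s. x ^ t) = (\<Sum>x\<in>#s. x ^ t')"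
    by (rule arg_cong[of _ _ sum_mset], rule image_mset_cong) (rule power_cong_exponent[OF s assms(2)])
  ultimately show ?thesis using assms(1) by (simp add: fixes_sum_def)
qed

text \<open>
  The sum of the \<open>t\<close>-th powers of the entries is itself a sum with the value of \<open>s\<close>; the
  conjugation by \<open>t'\<close> respects this equality.
\<close>
lemma fixes_sum_mult:
  assumes "fixes_sum s t" "fixes_sum s t'"
  shows "fixes_sum s (t * t')"
proof -
  have "(\<Sum>x\<in>#image_mset (\<lambda>x. x ^ t) s. x ^ t') = (\<Sum>x\<in>#s. x ^ t')"
  proof (rule power_sums_eq)
    fix x assume "x \<in># image_mset (\<lambda>x. x ^ t) s"
    then obtain y where y: "y \<in># s" "x = y ^ t" by auto
    have "x ^ p ^ k = (y ^ p ^ k) ^ t" unfolding y(2) by (simp add: mult.commute flip: power_mult)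
    thus "x ^ p ^ k = 1" using s[OF y(1)] by simp
  qed (use assms s in \<open>auto simp: fixes_sum_def\<close>)
  moreover have "\<not> p dvd t * t'"
    using assms prime_dvd_mult_iff[OF p] by (auto simp: fixes_sum_def)
  ultimately show ?thesis
    using assms by (simp add: fixes_sum_def image_mset.compositionality o_def power_mult)
qed

lemma fixes_sum_power: "fixes_sum s t \<Longrightarrow> fixes_sum s (t ^ e)"
  by (induction e) (use fixes_sum_1 fixes_sum_mult in auto)

text \<open>
  The powers of such a \<open>y = 1 + u * p ^ (k - 1)\<close>, with \<open>u\<close> prime to \<open>p\<close>, represent all
  \<open>1 + v * p ^ (k - 1)\<close>. These are the exponents of the averaging argument, so the value equals
  its own average.
\<close>
lemma order_part_eq_0_if_fixed:
  assumes y: "fixes_sum s y" "int p ^ (k - 1) dvd int y - 1" "\<not> int p ^ k dvd int y - 1"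
  shows "sum_mset (order_part s (p ^ k)) = 0"
proof -
  let ?N = "p ^ (k - 1)"
  have N: "?N > 0" "?N dvd ?N" "\<not> p ^ k dvd ?N"
    using p_gt_1 k power_dvd_imp_le[of p k "k - 1"] by auto
  have "y > 0" using y(1) by (cases y) (auto simp: fixes_sum_def)
  hence iy: "int y - 1 = int (y - 1)" by simp
  have "?N dvd y - 1" using y(2) unfolding iy by (simp flip: of_nat_power)
  then obtain u where "y - 1 = ?N * u" by (elim dvdE)
  hence u: "y = 1 + u * ?N" using \<open>y > 0\<close> by (simp add: mult.commute)
  have "\<not> p dvd u"
  proof
    assume "p dvd u"
    hence "p ^ k dvd y - 1" unfolding u power_p_k by simp
    thus False using y(3) unfolding iy by (simp flip: of_nat_power)
  qed
  have NN: "p ^ k dvd ?N * ?N"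
    using k by (simp flip: power_add) (intro le_imp_power_dvd, simp)
  have pow: "[y ^ e = 1 + e * u * ?N] (mod p ^ k)" for e
  proof (induction e)
    case (Suc e)
    have "[y * y ^ e = (1 + u * ?N) * (1 + e * u * ?N)] (mod p ^ k)"
      by (rule cong_mult) (use Suc in \<open>auto simp: u\<close>)
    also have "(1 + u * ?N) * (1 + e * u * ?N) = 1 + Suc e * u * ?N + (?N * ?N) * (u * e * u)"
      by (simp add: algebra_simps)
    also have "[\<dots> = 1 + Suc e * u * ?N + 0] (mod p ^ k)"
      by (rule cong_add) (use NN in \<open>auto simp: cong_0_iff\<close>)
    finally show ?case by simp
  qed simp
  have all: "(\<Sum>x\<in>#s. x ^ (1 + v * ?N)) = sum_mset s" for v
  proof -
    have "coprime u p" using \<open>\<not> p dvd u\<close> p prime_imp_coprime[of p u] by (simp add: coprime_commute)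
    then obtain i where "[u * i = 1] (mod p)" using cong_solve_coprime_nat[of u p] by auto
    hence "[v * (u * i) = v * 1] (mod p)" by (intro cong_mult) auto
    hence "[v * (u * i) * ?N = v * ?N] (mod p * ?N)" by (simp add: cong_mult_rcancel_nat cong_def mult_mod_left)
    hence "[1 + v * i * u * ?N = 1 + v * ?N] (mod p ^ k)"
      unfolding power_p_k by (intro cong_add) (auto simp: mult_ac)
    hence "[y ^ (v * i) = 1 + v * ?N] (mod p ^ k)" using pow[of "v * i"] cong_trans by blast
    from fixes_sum_cong[OF fixes_sum_power[OF y(1)] this] show ?thesis
      unfolding fixes_sum_def by (rule conjunct2)
  qed
  have "of_nat p * sum_mset s = of_nat p * (sum_mset s - sum_mset (order_part s (p ^ k)))"
    using sum_mset_averages[of s, OF s N] unfolding all by (simp only: sum_constant card_lessThan)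
  thus ?thesis using p_gt_1 by simp
qed

text \<open>
  The quotient \<open>r\<close> of two different exponents in the group that agree modulo \<open>p\<close> is a
  non-trivial element congruent to \<open>1\<close> modulo \<open>p\<close>. Some power of it satisfies the
  assumptions of \<open>order_part_eq_0_if_fixed\<close>.
\<close>
lemma fixes_sum_cong_mod_prime:
  assumes nz: "sum_mset (order_part s (p ^ k)) \<noteq> 0"
    and t: "fixes_sum s t" "fixes_sum s t'" "[t = t'] (mod p)"
  shows "[t = t'] (mod p ^ k)"
proof (rule ccontr)
  assume ne: "\<not> [t = t'] (mod p ^ k)"
  have cop: "coprime t' (p ^ k)"
    using t(2) p prime_imp_coprime[of p t'] by (simp add: coprime_commute fixes_sum_def)
  \<comment> \<open>the inverse of \<open>t'\<close> modulo \<open>p ^ k\<close>, taken as a power so that it stays in the group\<close>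
  define i where "i = t' ^ (totient (p ^ k) - 1)"
  have "totient (p ^ k) > 0" using p_gt_1 by simp
  hence "t' * i = t' ^ totient (p ^ k)"
    unfolding i_def by (metis power_eq_if not_gr_zero)
  hence i: "[t' * i = 1] (mod p ^ k)" using euler_theorem[OF cop] by simp
  define r where "r = t * i"
  have r: "fixes_sum s r" unfolding r_def i_def by (intro fixes_sum_mult fixes_sum_power t)
  have pk: "p dvd p ^ k" using k by (simp add: dvd_power)
  have "[t * i = t' * i] (mod p)" by (intro cong_mult t) simp
  also have "[t' * i = 1] (mod p)" by (rule cong_dvd_modulus_nat[OF i pk])
  finally have r1: "[r = 1] (mod p)" by (simp add: r_def)
  have r2: "\<not> [r = 1] (mod p ^ k)"
  proof
    assume "[r = 1] (mod p ^ k)"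
    hence "[r * t' = 1 * t'] (mod p ^ k)" by (intro cong_mult) auto
    moreover have "[t * (t' * i) = t * 1] (mod p ^ k)" by (intro cong_mult i) simp
    hence "[t = r * t'] (mod p ^ k)" by (simp add: r_def mult_ac cong_sym_eq)
    ultimately have "[t = 1 * t'] (mod p ^ k)" by (rule cong_trans[rotated])
    thus False using ne by simp
  qed
  have k1: "1 \<le> k - 1" using k by simp
  have dvd_iff: "int m dvd int c - 1
 \<longleftrightarrow> [c = 1] (mod m)" for m c
    by (metis cong_iff_dvd_diff cong_int_iff of_nat_1)
  obtain e where "int p ^ (k - 1) dvd int r ^ e - 1" "\<not> int p ^ k dvd int r ^ e - 1"
    using power_cong_1_exactly[of 1 "int r", OF _ k1] r1 r2 dvd_iff[of p r] dvd_iff[of "p ^ k" r] by auto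
  hence "sum_mset (order_part s (p ^ k)) = 0"
    by (intro order_part_eq_0_if_fixed[OF fixes_sum_power[OF r, of e]]) auto
  thus False using nz by contradiction
qed

end

end

section \<open>The degree of the cyclotomic field over the field of the sum\<close>
lemma rat_poly_value_sum: "rat_poly_value (\<Sum>i\<in>A. f i) x = (\<Sum>i\<in>A. rat_poly_value (f i) x)"
  by (induction A rule: infinite_finite_induct) simp_all

context
  fixes w :: complex and n t :: nat
  assumes n: "n > 0" and w: "w ^ n = 1" and t: "coprime t n"
begin

text \<open>The fixed elements of \<open>\<rat>(w)\<close> form a subfield, which contains \<open>\<rat>(a)\<close> once it contains \<open>a\<close>.\<close>
lemma galois_conj_fixes_rat_adjoin:
  assumes a: "a \<in> rat_adjoin w" "galois_conj w t a = a" and c: "c \<in> rat_adjoin a"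
  shows "galois_conj w t c = c"
proof -
  note Qw = rat_adjoin_root_of_unity[OF n w]
  note conj = galois_conj_add[OF n w t, folded Qw] galois_conj_mult[OF n w t, folded Qw]
  note rat = galois_conj_rat[OF n w t]
  note closed = subfield_complex_closed[OF subfield_rat_adjoin[of w]]
  have "c \<in> rat_adjoin w \<and> galois_conj w t c = c"
    using c unfolding rat_adjoin_def[of a]
  proof (induction c rule: generate_field.induct)
    case one
    show ?case using rat[of 1] closed by simp
  next
    case (incl h)
    thus ?case using a by simp
  next
    case (a_inv h)
    hence "galois_conj w t (of_rat (-1) * h) = of_rat (-1) * h"
      using conj(2)[of "of_rat (-1)" h] rat[of "-1"] subfield_complex_rat[OF subfield_rat_adjoin] by metis
    thus ?case using a_inv.IH closed by (simp add: of_rat_minus)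
  next
    case (m_inv h)
    hence h: "h \<noteq> 0" "h \<in> rat_adjoin w" "inverse h \<in> rat_adjoin w" using closed by auto
    have "h * galois_conj w t (inverse h) = galois_conj w t (h * inverse h)"
      using conj(2)[OF h(2,3)] m_inv.IH by simp
    also have "\<dots> = 1" using h rat[of 1] by simp
    finally have "galois_conj w t (inverse h) = inverse h"
      using h(1) by (simp add: field_simps)
    thus ?case using h by simp
  qed (use conj closed in auto)
  thus ?thesis by simp
qed

lemma galois_conj_poly_value:
  assumes "\<And>i. Polynomial.coeff f i \<in> rat_adjoin w" "\<And>i. galois_conj w t (Polynomial.coeff f i) = Polynomial.coeff f i"
  shows "poly f w \<in> rat_adjoin w \<and> galois_conj w t (poly f w) = poly f (w ^ t)"
  using assms
proof (induction f)
  case 0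
  show ?case using galois_conj_rat[OF n w t, of 0] subfield_complex_closed[OF subfield_rat_adjoin[of w]] by simp
next
  case (pCons c f)
  note Qw = rat_adjoin_root_of_unity[OF n w]
  note conj = galois_conj_add[OF n w t, folded Qw] galois_conj_mult[OF n w t, folded Qw]
  note closed = subfield_complex_closed[OF subfield_rat_adjoin[of w]]
  have IH: "poly f w \<in> rat_adjoin w \<and> galois_conj w t (poly f w) = poly f (w ^ t)"
    using pCons.IH pCons.prems(1)[of "Suc _"] pCons.prems(2)[of "Suc _"] by simp
  have c: "c \<in> rat_adjoin w" "galois_conj w t c = c" using pCons.prems[of 0] by auto
  have "galois_conj w t w = w ^ t" using galois_conj_power[OF n w t, of 1] by simp
  thus ?case using IH c conj rat_adjoin_self[of w] by (simp add: closed)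
qed

end

text \<open>A common root of \<open>f\<close> and its derivative would be a multiple root of \<open>X ^ n - 1\<close>.\<close>
lemma card_roots_dvd_monom_diff_1:
  fixes f :: "complex poly"
  assumes n: "n > 0" and f: "f dvd monom 1 n - 1"
  shows "card {x. poly f x = 0} = Polynomial.degree f" "finite {x. poly f x = 0}"
proof -
  obtain h where h: "monom 1 n - 1 = f * h" using f by (elim dvdE)
  have U0: "(monom 1 n - 1 :: complex poly) \<noteq> 0"
    using n by (auto simp: poly_eq_iff intro!: exI[of _ n])
  hence f0: "f \<noteq> 0" using h by auto
  show fin: "finite {x. poly f x = 0}" using f0 by (rule poly_roots_finite)
  have "rsquarefree f"
    unfolding rsquarefree_roots
  proof (intro allI notI, elim conjE)
    fix x assume x: "poly f x = 0" "poly (pderiv f) x = 0"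
    have "poly (pderiv (monom 1 n - 1)) x = 0" unfolding h using x by (simp add: pderiv_mult)
    hence "x ^ (n - 1) = 0" using n by (simp add: pderiv_diff pderiv_monom poly_monom)
    moreover have "poly (monom 1 n - 1) x = 0" unfolding h using x by simp
    hence "x ^ n = 1" by (simp add: poly_monom)
    ultimately show False using n by (auto simp: zero_power)
  qed
  hence dec: "smult (lead_coeff f) (\<Prod>x | poly f x = 0. [:- x, 1:]) = f"
    by (rule complex_poly_decompose_rsquarefree)
  have "Polynomial.degree f = Polynomial.degree (\<Prod>x | poly f x = 0. [:- x, 1:])"
    by (subst dec[symmetric]) (use f0 in simp)
  also have "\<dots> = card {x. poly f x = 0}"
    by (subst degree_prod_eq_sum_degree) auto
  finally show "card {x. poly f x = 0} = Polynomial.degree f" by simp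
qed

context odd_prime_power
begin

abbreviation (input) zeta :: complex where "zeta \<equiv> cis (2 * pi / real (p ^ k))"

text \<open>The conjugates of \<open>zeta\<close> over the field generated by the value of \<open>s\<close>.\<close>
definition conjugates :: "complex multiset \<Rightarrow> complex set" where
  "conjugates s = (\<lambda>t. zeta ^ t) ` {t. fixes_sum s t}"

lemma prime_power_pos: "p ^ k > 0" using p_gt_1 by simp

lemma zeta_power: "zeta ^ p ^ k = 1" by (rule cis_power_eq_1[OF prime_power_pos])

lemma ex_zeta_power: "x ^ p ^ k = 1 \<Longrightarrow> \<exists>j. x = zeta ^ j"
  using root_of_unity_iff_cis_power[OF prime_power_pos, of x] by blast

lemma zeta_power_eq_iff: "zeta ^ i = zeta ^ j \<longleftrightarrow> [i = j] (mod p ^ k)"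
proof
  assume eq: "zeta ^ i = zeta ^ j"
  have inj: "inj_on (\<lambda>j. cis (2 * pi * real j / real (p ^ k))) {..<p ^ k}"
    using bij_betw_roots_unity[OF prime_power_pos] by (rule bij_betw_imp_inj_on)
  have pow: "zeta ^ i = cis (2 * pi * real (i mod p ^ k) / real (p ^ k))" for i
  proof -
    have "zeta ^ i = zeta ^ (i mod p ^ k)"
      by (rule power_cong_exponent[OF zeta_power]) (simp add: cong_def)
    also have "\<dots> = cis (2 * pi * real (i mod p ^ k) / real (p ^ k))"
      unfolding Complex.DeMoivre by (simp only: times_divide_eq_right mult_ac)
    finally show ?thesis .
  qed
  have "i mod p ^ k = j mod p ^ k"
    using inj_onD[OF inj, of "i mod p ^ k" "j mod p ^ k"] eq prime_power_pos unfolding pow[of i] pow[of j] by simp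
  thus "[i = j] (mod p ^ k)" by (simp add: cong_def)
qed (rule power_cong_exponent[OF zeta_power])

context
  fixes s :: "complex multiset"
  assumes s: "\<And>x. x \<in># s \<Longrightarrow> x ^ p ^ k = 1"
begin

lemma galois_conj_zeta_sum:
  assumes "\<not> p dvd t"
  shows "coprime t (p ^ k)" "galois_conj zeta t (sum_mset s) = (\<Sum>x\<in>#s. x ^ t)"
proof -
  show cop: "coprime t (p ^ k)"
    using assms p prime_imp_coprime[of p t] by (simp add: coprime_commute)
  show "galois_conj zeta t (sum_mset s) = (\<Sum>x\<in>#s. x ^ t)"
    by (rule galois_conj_sum_mset[OF prime_power_pos zeta_power cop]) (use ex_zeta_power s in blast)
qed

lemma sum_mem_rat_adjoin_zeta: "sum_mset s \<in> rat_adjoin zeta"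
  using sum_mset_mem_cyclotomic_field[OF s prime_power_pos] by (simp only: cyclotomic_field_def)

text \<open>
  The roots of the minimal polynomial \<open>f\<close> of \<open>zeta\<close> over \<open>\<rat>(|s|)\<close> are the conjugates.
  Write \<open>|s| = g(zeta)\<close> with \<open>g\<close> rational. Since \<open>f\<close> divides \<open>X ^ (p ^ k) - 1\<close>, the
  \<open>p ^ k\<close>-th cyclotomic polynomial and \<open>g - |s|\<close>, a root is \<open>zeta ^ t\<close> with \<open>t\<close> prime to
  \<open>p\<close> and \<open>g(zeta ^ t) = |s|\<close>, that is, conjugation by \<open>t\<close> fixes \<open>|s|\<close>. Conversely
  such a conjugation fixes the coefficients of \<open>f\<close>, and so maps the root \<open>zeta\<close> to a root.
\<close>
lemma field_degree_eq_card_conjugates: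
  "field_degree (cyclotomic_field (p ^ k)) (sum_field s) = card (conjugates s)"
proof -
  let ?a = "sum_mset s" and ?K = "rat_adjoin (sum_mset s)"
  note K = subfield_rat_adjoin[of ?a]
  obtain f where f: "poly f zeta = 0" "\<And>i. Polynomial.coeff f i \<in> ?K"
    "Polynomial.degree f = field_degree (CF.simple_extension ?K zeta) ?K"
    and fdvd': "\<forall>q. (\<forall>i. Polynomial.coeff q i \<in> ?K) \<longrightarrow> poly q zeta = 0 \<longrightarrow> f dvd q"
    using field_degree_minimal_polynomial[OF K prime_power_pos zeta_power] by blast
  have fdvd: "f dvd q" if "\<And>i. Polynomial.coeff q i \<in> ?K" "poly q zeta = 0" for q
    using fdvd' that by blast
  have deg: "Polynomial.degree f = field_degree (cyclotomic_field (p ^ k)) (sum_field s)"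
    unfolding f(3) cyclotomic_field_def sum_field_def
    by (simp only: rat_adjoin_eq_simple_extension[OF prime_power_pos zeta_power sum_mem_rat_adjoin_zeta])
  have root_rat: "rat_poly_value g x = 0" if g: "rat_poly_value g zeta = 0" and x: "poly f x = 0" for g x
  proof -
    have "f dvd map_poly of_rat g"
      by (rule fdvd) (use g in \<open>auto simp: coeff_map_poly rat_poly_value_def subfield_complex_rat[OF K]\<close>)
    thus ?thesis using x by (auto simp: rat_poly_value_def elim!: dvdE)
  qed
  obtain g where g: "?a = rat_poly_value g zeta"
    using sum_mem_rat_adjoin_zeta
    unfolding rat_adjoin_root_of_unity[OF prime_power_pos zeta_power] rat_polys_at_def by auto
  have root_a: "rat_poly_value g x = ?a" if x: "poly f x = 0" for x
  proof -
    have "f dvd map_poly of_rat g + [:- ?a:]"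
    proof (rule fdvd)
      show "Polynomial.coeff (map_poly of_rat g + [:- ?a:]) i \<in> ?K" for i
        using subfield_complex_closed[OF K] subfield_complex_rat[OF K] rat_adjoin_self[of ?a]
        by (cases i) (auto simp: coeff_map_poly coeff_pCons simp del: add_uminus_conv_diff)
    qed (use g in \<open>simp add: rat_poly_value_def\<close>)
    then obtain h where "map_poly of_rat g + [:- ?a:] = f * h" by (elim dvdE)
    hence "poly (map_poly of_rat g + [:- ?a:]) x = poly (f * h) x" by (simp only:)
    thus ?thesis using x by (simp add: rat_poly_value_def)
  qed
  have "{x. poly f x = 0} = conjugates s"
  proof (intro equalityI subsetI)
    fix x assume "x \<in> {x. poly f x = 0}"
    hence x: "poly f x = 0" by simp
    have "x ^ p ^ k = 1"
      using root_rat[of "monom 1 (p ^ k) - 1" x] x zeta_power by simp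
    then obtain t where t: "x = zeta ^ t" using ex_zeta_power by blast
    \<comment> \<open>the sum \<open>1 + X ^ ?q + \<dots> + X ^ (?q * (p - 1))\<close> used below is the cyclotomic polynomial\<close>
    let ?q = "p ^ (k - 1)"
    have "zeta ^ ?q \<noteq> 1"
    proof
      assume "zeta ^ ?q = 1"
      hence "[?q = 0] (mod p ^ k)" using zeta_power_eq_iff[of ?q 0] by simp
      hence "p ^ k dvd ?q" by (simp add: cong_0_iff)
      thus False using p_gt_1 k power_dvd_imp_le[of p k "k - 1"] by auto
    qed
    moreover have pw: "(y ^ ?q) ^ p = 1" if "y ^ p ^ k = 1" for y :: complex
      using that unfolding power_p_k by (simp add: mult.commute flip: power_mult)
    ultimately have "rat_poly_value (\<Sum>i<p. monom 1 (?q * i)) zeta = 0"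
      using sum_powers_root_of_unity[OF pw[OF zeta_power]] by (simp add: rat_poly_value_sum power_mult)
    hence "rat_poly_value (\<Sum>i<p. monom 1 (?q * i)) x = 0" using x by (rule root_rat)
    hence "(\<Sum>i<p. (x ^ ?q) ^ i) = 0" by (simp add: rat_poly_value_sum power_mult)
    hence xq: "x ^ ?q \<noteq> 1" using p_gt_1 by auto
    have nd: "\<not> p dvd t"
    proof
      assume "p dvd t"
      hence "p ^ k dvd t * ?q" unfolding power_p_k by (intro mult_dvd_mono) auto
      hence "x ^ ?q = 1" unfolding t using zeta_power power_eq_1_dvd by (simp only: power_mult[symmetric])
      thus False using xq by contradiction
    qed
    note t' = galois_conj_zeta_sum[OF nd]
    have "(\<Sum>x\<in>#s. x ^ t) = rat_poly_value g x"
      unfolding t'(2)[symmetric] g t by (rule galois_conj_value[OF prime_power_pos zeta_power t'(1)])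
    also have "\<dots> = ?a" by (rule root_a[OF x])
    finally show "x \<in> conjugates s" using t nd by (auto simp: conjugates_def fixes_sum_def)
  next
    fix x assume "x \<in> conjugates s"
    then obtain t where t: "x = zeta ^ t" "\<not> p dvd t" "(\<Sum>x\<in>#s. x ^ t) = ?a"
      by (auto simp: conjugates_def fixes_sum_def)
    note t' = galois_conj_zeta_sum[OF t(2)]
    have "Polynomial.coeff f i \<in> rat_adjoin zeta" for i
      using f(2) sum_mem_rat_adjoin_zeta rat_adjoin_subset_iff by blast
    moreover have "galois_conj zeta t (Polynomial.coeff f i) = Polynomial.coeff f i" for i
      using galois_conj_fixes_rat_adjoin[OF prime_power_pos zeta_power t'(1) sum_mem_rat_adjoin_zeta _ f(2)] t(3) t'(2)
      by simp
    ultimately have "galois_conj zeta t (poly f zeta) = poly f x"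
      using galois_conj_poly_value[OF prime_power_pos zeta_power t'(1), of f] t(1) by blast
    thus "x \<in> {x. poly f x = 0}"
      using f(1) galois_conj_rat[OF prime_power_pos zeta_power t'(1), of 0] by simp
  qed
  moreover have "f dvd monom 1 (p ^ k) - 1"
    by (rule fdvd) (auto simp: coeff_1 poly_monom zeta_power intro!: subfield_complex_closed[OF K]
      simp flip: add_uminus_conv_diff simp del: of_nat_power)
  ultimately show ?thesis
    using card_roots_dvd_monom_diff_1(1)[OF prime_power_pos, of f] deg by simp
qed

lemma conjugates_basic: "finite (conjugates s)" "zeta \<in> conjugates s" "x \<in> conjugates s \<Longrightarrow> x ^ p ^ k = 1"
proof -
  have pow: "x ^ p ^ k = 1" if x: "x \<in> conjugates s" for x
  proof -
    obtain t where t: "x = zeta ^ t" using x unfolding conjugates_def by blast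
    have "x ^ p ^ k = (zeta ^ p ^ k) ^ t" unfolding t by (simp only: power_mult[symmetric] mult.commute)
    thus ?thesis unfolding zeta_power by simp
  qed
  thus "x \<in> conjugates s \<Longrightarrow> x ^ p ^ k = 1" .
  have "conjugates s \<subseteq> {x. x ^ p ^ k = 1}" using pow by auto
  moreover have "finite {x :: complex. x ^ p ^ k = 1}" using prime_power_pos by (intro finite_roots_unity) auto
  ultimately show "finite (conjugates s)" by (rule finite_subset)
  show "zeta \<in> conjugates s"
    unfolding conjugates_def by (rule image_eqI[of _ _ 1]) (use fixes_sum_1[of s, OF s] in auto)
qed

text \<open>
  Here \<open>|s|\<close> is a polynomial in \<open>zeta ^ p\<close>, so the conjugate of \<open>|s|\<close> under \<open>t\<close> depends
  on \<open>(zeta ^ t) ^ p\<close> only, which a factor \<open>r\<close> with \<open>r ^ p = 1\<close> does not change.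
\<close>
lemma prime_dvd_card_conjugates:
  assumes z: "sum_mset (order_part s (p ^ k)) = 0"
  shows "p dvd card (conjugates s)"
proof -
  let ?q = "p ^ (k - 1)"
  have q: "?q > 0" using p_gt_1 by simp
  have zp: "cis (2 * pi / real ?q) = zeta ^ p"
    using cis_power_dvd[OF prime_power_pos, of ?q] q power_p_k by simp
  have "sum_mset s \<in> rat_polys_at (zeta ^ p)"
    using sum_mset_mem_cyclotomic_field_if_order_part_0[of s, OF s z]
    unfolding cyclotomic_field_def rat_adjoin_root_of_unity[OF q cis_power_eq_1[OF q]] unfolding zp .
  then obtain g where g: "sum_mset s = rat_poly_value g (zeta ^ p)" by (auto simp: rat_polys_at_def)
  have inv: "r * x \<in> conjugates s" if x: "x \<in> conjugates s" and r: "r ^ p = 1" for x r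
  proof -
    obtain t where t: "x = zeta ^ t" "\<not> p dvd t" "(\<Sum>x\<in>#s. x ^ t) = sum_mset s"
      using x by (auto simp: conjugates_def fixes_sum_def)
    have "r ^ p ^ k = 1" using r by (simp add: power_p_k power_mult)
    then obtain i where i: "r = zeta ^ i" using ex_zeta_power by blast
    have "zeta ^ (i * p) = zeta ^ 0" using r unfolding i by (simp only: power_mult power_0)
    hence "p ^ k dvd i * p" unfolding zeta_power_eq_iff by (simp only: cong_0_iff)
    hence "p * ?q dvd p * i" by (simp only: power_p_k mult.commute)
    hence "?q dvd i" using p_gt_1 by simp
    moreover have "p dvd ?q" using k by (simp add: dvd_power)
    ultimately have "p dvd i" using dvd_trans by blast
    hence nd: "\<not> p dvd i + t" using t(2) by (simp add: dvd_add_right_iff)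
    note ti = galois_conj_zeta_sum[OF nd] and tt = galois_conj_zeta_sum[OF t(2)]
    have val: "galois_conj zeta c (sum_mset s) = rat_poly_value g ((zeta ^ c) ^ p)" if "coprime c (p ^ k)" for c
      using galois_conj_value[OF prime_power_pos zeta_power that, of "pcompose g (monom 1 p)"] by (simp add: g)
    have "(zeta ^ (i + t)) ^ p = (r * zeta ^ t) ^ p" unfolding i by (simp only: power_add)
    also have "\<dots> = (zeta ^ t) ^ p" using r by (simp only: power_mult_distrib mult_1)
    finally have "(\<Sum>x\<in>#s. x ^ (i + t)) = sum_mset s"
      using val[OF ti(1)] val[OF tt(1)] ti(2) tt(2) t(3) by simp
    thus ?thesis using nd unfolding i t(1) conjugates_def fixes_sum_def
      by (intro image_eqI[of _ _ "i + t"]) (auto simp only: power_add mem_Collect_eq)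
  qed
  have "0 \<notin> conjugates s" using conjugates_basic(3)[of 0] prime_power_pos by (auto simp: zero_power)
  thus ?thesis
    using prime_dvd_sum_of_invariant[OF conjugates_basic(1), of "\<lambda>_. 1"] inv by simp
qed

text \<open>
  By \<open>fixes_sum_cong_mod_prime\<close> the map \<open>x \<mapsto> x ^ (p ^ (k - 1))\<close> is injective on the
  conjugates, and its values are primitive \<open>p\<close>-th roots of unity, of which there are
  \<open>p - 1\<close>.
\<close>
lemma card_conjugates_less:
  assumes nz: "sum_mset (order_part s (p ^ k)) \<noteq> 0"
  shows "card (conjugates s) < p" "card (conjugates s) > 0"
proof -
  let ?q = "p ^ (k - 1)"
  show "card (conjugates s) > 0"
    using conjugates_basic(1,2) by (auto simp: card_gt_0_iff)
  have "inj_on (\<lambda>x. x ^ ?q) (conjugates s)"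
  proof (rule inj_onI)
    fix x y assume "x \<in> conjugates s" "y \<in> conjugates s" and eq: "x ^ ?q = y ^ ?q"
    then obtain t t' where t: "x = zeta ^ t" "fixes_sum s t" "y = zeta ^ t'" "fixes_sum s t'"
      by (auto simp: conjugates_def)
    have "zeta ^ (t * ?q) = zeta ^ (t' * ?q)" using eq unfolding t(1,3) by (simp only: power_mult)
    hence "[t * ?q = t' * ?q] (mod p ^ k)" unfolding zeta_power_eq_iff .
    hence "[t * ?q = t' * ?q] (mod p * ?q)" by (simp only: power_p_k)
    hence "[t = t'] (mod p)" using p_gt_1 by (simp add: cong_def mult_mod_left[symmetric])
    hence "[t = t'] (mod p ^ k)" using fixes_sum_cong_mod_prime[of s t t'] s nz t(2,4) by blast
    thus "x = y" unfolding t(1,3) zeta_power_eq_iff .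
  qed
  moreover have "(\<lambda>x. x ^ ?q) ` conjugates s \<subseteq> {r. r ^ p = 1} - {1}"
  proof (intro image_subsetI)
    fix x assume x: "x \<in> conjugates s"
    have "(x ^ ?q) ^ p = 1"
      using conjugates_basic(3)[OF x] unfolding power_p_k by (simp only: mult.commute[of p] power_mult)
    moreover have "x ^ ?q \<noteq> 1"
    proof
      assume 1: "x ^ ?q = 1"
      obtain t where t: "x = zeta ^ t" "\<not> p dvd t" using x by (auto simp: conjugates_def fixes_sum_def)
      have "zeta ^ (t * ?q) = zeta ^ 0" using 1 unfolding t(1) by (simp only: power_mult power_0)
      hence "p ^ k dvd t * ?q" unfolding zeta_power_eq_iff by (simp only: cong_0_iff)
      hence "p * ?q dvd t * ?q" by (simp only: power_p_k)
      thus False using t(2) p_gt_1 by simp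
    qed
    ultimately show "x ^ ?q \<in> {r. r ^ p = 1} - {1}" by simp
  qed
  moreover have fin: "finite {r :: complex. r ^ p = 1}" using p_gt_1 by (intro finite_roots_unity) auto
  ultimately have "card (conjugates s) \<le> card ({r :: complex. r ^ p = 1} - {1})"
    by (intro card_inj_on_le) auto
  also have "\<dots> = p - 1" using p_gt_1 fin by (simp add: card_roots_unity_eq card_Diff_singleton)
  finally show "card (conjugates s) < p" using p_gt_1 by simp
qed

lemma prime_dvd_field_degree_iff:
  "p dvd field_degree (cyclotomic_field (p ^ k)) (sum_field s) \<longleftrightarrow> sum_mset (order_part s (p ^ k)) = 0"
  unfolding field_degree_eq_card_conjugates
  using prime_dvd_card_conjugates card_conjugates_less by (auto dest: nat_dvd_not_less)

end
end

theorem theorem2p5: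
  fixes p k :: nat and z :: complex and a :: "int list" and s :: "complex multiset"
  assumes "Factorial_Ring.prime p" and "odd p" and "k \<ge> 2"
    and "primitive_root_of_unity (p ^ k) z"
    and "s = root_sum z a"
  shows
    "(equiv (root_sums z) (same_value z) \<and>
      (\<forall>C \<in> root_sums z // same_value z. \<exists>!t. minimal_representative C t) \<and>
      (\<forall>s1 \<in> root_sums z. \<forall>s2 \<in> root_sums z. sum_mset s1 = sum_mset s2 \<longrightarrow>
         sum_mset (order_part s1 (p ^ k)) = sum_mset (order_part s2 (p ^ k)))) \<and>
     ((conductor s = p ^ k \<longleftrightarrow> sum_mset (order_part s (p ^ k)) \<noteq> 0) \<and>
      (\<not> p dvd order_count s (p ^ k) \<or> \<not> p dvd distinct_order_count s (p ^ k) \<longrightarrow>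
         conductor s = p ^ k)) \<and>
     ((p dvd field_degree (cyclotomic_field (p ^ k)) (sum_field s) \<longleftrightarrow>
         sum_mset (order_part s (p ^ k)) = 0) \<and>
      (\<not> p dvd order_count s (p ^ k) \<or> \<not> p dvd distinct_order_count s (p ^ k) \<longrightarrow>
         \<not> p dvd field_degree (cyclotomic_field (p ^ k)) (sum_field s)))"
proof -
  interpret odd_prime_power p k
    using assms by unfold_locales
  note rs = root_sums_eq[OF assms(4)]
  have "s \<in> root_sums z" by (simp add: assms(5) root_sums_def)
  hence s: "x ^ p ^ k = 1" if "x \<in># s" for x using that rs by simp
  have "equiv (root_sums z) (same_value z)"
    by (auto simp: equiv_def refl_on_def sym_def trans_def same_value_def)
  moreover have "\<forall>C \<in> root_sums z // same_value z. \<exists>!t. minimal_representative C t"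
    using ex1_minimal_representative[OF assms(4)] by blast
  moreover have "\<forall>s1 \<in> root_sums z. \<forall>s2 \<in> root_sums z. sum_mset s1 = sum_mset s2 \<longrightarrow>
         sum_mset (order_part s1 (p ^ k)) = sum_mset (order_part s2 (p ^ k))"
    unfolding rs using order_parts_eq by blast
  ultimately show ?thesis
    using conductor_eq_iff[of s, OF s] prime_dvd_field_degree_iff[of s, OF s] prime_dvd_order_counts[of s, OF s]
    by blast
qed

end
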